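(* Let $(X,\mu)$ be a discrete measure space, let $\mathcal{H}=L^2(X,\mu)$, let $U\in\mathcal{B}(\mathcal{H})$ be a unitary operator, and let $\mathcal{A}\subseteq\mathcal{B}(\mathcal{H})$ be an abelian self-adjoint algebra that is contained in the algebra $\{M_f : f\in L^\infty(X,\mu)\}$ of multiplication operators. If $U^*\mathcal{A}U=\mathcal{A}$, then there is a maximal abelian self-adjoint subalgebra (masa) $\mathcal{B}$ of $\mathcal{B}(\mathcal{H})$ such that $\mathcal{A}\subseteq\mathcal{B}$ and $\mathcal{B}$ is $U$-invariant, i.e. $U^*\mathcal{B}U\subseteq\mathcal{B}$.
   Context: Hilbert spaces are complex; $\mathcal{H}$ is infinite dimensional and separable, and $(X,\mu)$ is $\sigma$-finite and complete. A discrete measure space here is a (countable) set $X$ in which all subsets are measurable and each point has positive finite measure. $\mathcal{B}(\mathcal{H})$ is the algebra of bounded linear operators on $\mathcal{H}$. For $f\in L^\infty(X,\mu)$, $M_f$ is the multiplication operator $M_f k=fk$ on $L^2(X,\mu)$. A set $\mathcal{A}\subseteq\mathcal{B}(\mathcal{H})$ is called self-adjoint if $A\in\mathcal{A}$ implies $A^*\in\mathcal{A}$. A masa is an abelian self-adjoint subalgebra of $\mathcal{B}(\mathcal{H})$ that is maximal (under inclusion) among abelian self-adjoint subalgebras. For a unitary $U$, a set $\mathcal{A}\subseteq\mathcal{B}(\mathcal{H})$ is called $U$-invariant if $U^*AU\in\mathcal{A}$ for every $A\in\mathcal{A}$. *)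

theory Defs
  imports "HOL-Analysis.Analysis"
begin

definition discrete_measure_space :: "'a measure \<Rightarrow> bool" where
  "discrete_measure_space M \<longleftrightarrow>
     countable (space M) \<and> sets M = Pow (space M) \<and>
     (\<forall>x\<in>space M. 0 < emeasure M {x} \<and> emeasure M {x} < \<infinity>)"

text \<open>
  In a discrete measure space the only null set is the empty one, so equality almost
  everywhere is equality on the underlying set, and an element of \<open>L\<^sup>2(X,\<mu>)\<close> is a
  square-integrable function rather than a class of such functions. Functions are
  normalised to be \<open>0\<close> off \<open>space M\<close>, so that equality in HOL is equality in \<open>L\<^sup>2\<close>.
\<close>

definition L2 :: "'a measure \<Rightarrow> ('a \<Rightarrow> complex) set" where
  "L2 M = {f. f \<in> borel_measurable M \<and> integrable M (\<lambda>x. (cmod (f x))\<^sup>2) \<and>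
              (\<forall>x. x \<notin> space M \<longrightarrow> f x = 0)}"

definition L2_inner :: "'a measure \<Rightarrow> ('a \<Rightarrow> complex) \<Rightarrow> ('a \<Rightarrow> complex) \<Rightarrow> complex" where
  "L2_inner M f g = (\<integral>x. f x * cnj (g x) \<partial>M)"

definition L2_norm :: "'a measure \<Rightarrow> ('a \<Rightarrow> complex) \<Rightarrow> real" where
  "L2_norm M f = sqrt (\<integral>x. (cmod (f x))\<^sup>2 \<partial>M)"

definition L2_infinite_dimensional :: "'a measure \<Rightarrow> bool" where
  "L2_infinite_dimensional M \<longleftrightarrow>
     \<not> (\<exists>B\<subseteq>L2 M. finite B \<and> (\<forall>f\<in>L2 M. \<exists>c. f = (\<lambda>x. \<Sum>b\<in>B. c b * b x)))"

definition Linf :: "'a measure \<Rightarrow> ('a \<Rightarrow> complex) set" where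
  "Linf M = {f. f \<in> borel_measurable M \<and> (\<exists>C. AE x in M. cmod (f x) \<le> C)}"

type_synonym 'a operator = "('a \<Rightarrow> complex) \<Rightarrow> ('a \<Rightarrow> complex)"

text \<open>
  The bounded linear operators on \<open>L\<^sup>2(X,\<mu>)\<close>. They are normalised to vanish at
  arguments outside \<open>L2 M\<close>, so that equality in HOL is equality of operators. This
  normal form is preserved by pointwise sums, scalar multiples and \<open>\<circ>\<close>.
\<close>

definition bounded_ops :: "'a measure \<Rightarrow> 'a operator set" where
  "bounded_ops M =
     {T. (\<forall>f\<in>L2 M. T f \<in> L2 M) \<and>
         (\<forall>f\<in>L2 M. \<forall>g\<in>L2 M. T (\<lambda>x. f x + g x) = (\<lambda>x. T f x + T g x)) \<and>
         (\<forall>c. \<forall>f\<in>L2 M. T (\<lambda>x. c * f x) = (\<lambda>x. c * T f x)) \<and>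
         (\<exists>K. \<forall>f\<in>L2 M. L2_norm M (T f) \<le> K * L2_norm M f) \<and>
         (\<forall>f. f \<notin> L2 M \<longrightarrow> T f = (\<lambda>x. 0))}"

definition id_op :: "'a measure \<Rightarrow> 'a operator" where
  "id_op M = (\<lambda>f. if f \<in> L2 M then f else (\<lambda>x. 0))"

definition mult_op :: "'a measure \<Rightarrow> ('a \<Rightarrow> complex) \<Rightarrow> 'a operator" where
  "mult_op M f = (\<lambda>k. if k \<in> L2 M then (\<lambda>x. f x * k x) else (\<lambda>x. 0))"

text \<open>For \<open>T \<in> bounded_ops M\<close> the adjoint exists and is unique, by the Riesz representation theorem.\<close>

definition adj :: "'a measure \<Rightarrow> 'a operator \<Rightarrow> 'a operator" where
  "adj M T = (THE S. S \<in> bounded_ops M \<and>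
     (\<forall>f\<in>L2 M. \<forall>g\<in>L2 M. L2_inner M (T f) g = L2_inner M f (S g)))"

definition unitary_op :: "'a measure \<Rightarrow> 'a operator \<Rightarrow> bool" where
  "unitary_op M U \<longleftrightarrow>
     U \<in> bounded_ops M \<and> adj M U \<circ> U = id_op M \<and> U \<circ> adj M U = id_op M"

text \<open>A subalgebra need not contain the identity and need not be closed in any topology.\<close>

definition op_subalgebra :: "'a measure \<Rightarrow> 'a operator set \<Rightarrow> bool" where
  "op_subalgebra M \<A> \<longleftrightarrow>
     \<A> \<subseteq> bounded_ops M \<and> (\<lambda>f x. 0) \<in> \<A> \<and>
     (\<forall>S\<in>\<A>. \<forall>T\<in>\<A>. (\<lambda>f x. S f x + T f x) \<in> \<A>) \<and>
     (\<forall>c. \<forall>T\<in>\<A>. (\<lambda>f x. c * T f x) \<in> \<A>) \<and>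
     (\<forall>S\<in>\<A>. \<forall>T\<in>\<A>. S \<circ> T \<in> \<A>)"

definition self_adjoint_set :: "'a measure \<Rightarrow> 'a operator set \<Rightarrow> bool" where
  "self_adjoint_set M \<A> \<longleftrightarrow> (\<forall>T\<in>\<A>. adj M T \<in> \<A>)"

definition abelian_self_adjoint_algebra :: "'a measure \<Rightarrow> 'a operator set \<Rightarrow> bool" where
  "abelian_self_adjoint_algebra M \<A> \<longleftrightarrow>
     op_subalgebra M \<A> \<and> self_adjoint_set M \<A> \<and> (\<forall>S\<in>\<A>. \<forall>T\<in>\<A>. S \<circ> T = T \<circ> S)"

definition masa :: "'a measure \<Rightarrow> 'a operator set \<Rightarrow> bool" where
  "masa M \<B> \<longleftrightarrow>
     abelian_self_adjoint_algebra M \<B> \<and>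
     (\<forall>\<C>. abelian_self_adjoint_algebra M \<C> \<and> \<B> \<subseteq> \<C> \<longrightarrow> \<C> = \<B>)"

definition conj_op :: "'a measure \<Rightarrow> 'a operator \<Rightarrow> 'a operator \<Rightarrow> 'a operator" where
  "conj_op M U T = adj M U \<circ> T \<circ> U"

definition U_invariant :: "'a measure \<Rightarrow> 'a operator \<Rightarrow> 'a operator set \<Rightarrow> bool" where
  "U_invariant M U \<A> \<longleftrightarrow> (\<forall>T\<in>\<A>. conj_op M U T \<in> \<A>)"

end

theory Submission
  imports Defs
begin

text \<open>
  Every element of \<open>\<A>\<close> is a multiplication operator, so the space splits into the level
  sets of \<open>\<A>\<close>, the classes of points that no symbol of \<open>\<A>\<close> separates. Write \<open>P\<^sub>E\<close> for the
  projection onto the functions that live on a level set \<open>E\<close>. The ranges of the \<open>P\<^sub>E\<close> are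
  the joint eigenspaces of \<open>\<A>\<close>, and conjugation by \<open>U\<close> maps \<open>\<A>\<close> onto itself, so \<open>U\<close> permutes
  them: \<open>U P\<^sub>E = P\<^sub>F U\<close> (\<open>unitary_permutes_level_sets\<close>). This is where discreteness enters.

  Within one orbit of this permutation a masa can be picked on a single block and carried to
  the other blocks by the powers of \<open>U\<close>. The only obstruction is that a power of \<open>U\<close> may
  return to the block it started from, and then it has to normalise the chosen masa. A power
  that returns acts on the block as a unitary, all these unitaries commute, and so a masa of
  the block can be chosen that contains them.

  The lemma \<open>exists_invariant_masa\<close> carries this out with commutants, which avoids operators
  on the single blocks. Let \<open>G\<close> be the group generated by \<open>U\<close>. The compressions \<open>P\<^sub>E V P\<^sub>E\<close>
  with \<open>V \<in> G\<close> commute and form a self-adjoint set, so by Zorn's lemma they lie in a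
  self-adjoint set \<open>\<C>\<close> that is its own commutant (\<open>self_commutant_extension\<close>). Choose one
  block in each orbit and let \<open>\<N>\<close> consist of the operators \<open>V P\<^sub>E c P\<^sub>E V\<^sup>*\<close> with \<open>V \<in> G\<close>,
  \<open>E\<close> a chosen block and \<open>c \<in> \<C>\<close>. Two such operators commute: either they live on
  orthogonal blocks, or they live on the same block and the two transports differ by a
  power that returns, which commutes with \<open>\<C>\<close>. The masa is the commutant \<open>\<B>\<close> of \<open>\<N>\<close>. An
  element \<open>T\<close> of \<open>\<B>\<close> is determined by the compressions \<open>P\<^sub>E V\<^sup>* T V P\<^sub>E\<close>, which commute with
  \<open>\<C>\<close> and therefore lie in \<open>\<C>\<close>; hence \<open>\<B>\<close> is commutative. As \<open>\<N>\<close> is commutative too, \<open>\<B>\<close>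
  equals its own commutant, and a self-adjoint set with this property is a masa
  (\<open>masa_if_own_commutant\<close>). Conjugation by \<open>G\<close> preserves \<open>\<N>\<close> and so \<open>\<B>\<close>, and the elements of
  \<open>\<A>\<close> are scalar on every block, so they commute with \<open>\<N>\<close>.

  Commutants and adjoints interact well only if every bounded operator has an adjoint. On
  a discrete space the adjoint can be written down by its values at points
  (\<open>adjoint_exists\<close>).
\<close>

section \<open>The Hilbert space of a discrete measure space\<close>

locale discrete_L2 =
  fixes M :: "'a measure"
  assumes discrete: "discrete_measure_space M"
begin

lemma measurable_all: "f \<in> space M \<rightarrow> space N \<Longrightarrow> f \<in> measurable M N"
  using discrete by (auto simp: discrete_measure_space_def measurable_def)

lemma borel_all [measurable, simp]: "(f :: 'a \<Rightarrow> 'b::topological_space) \<in> borel_measurable M"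
  by (rule measurable_all) auto

lemma sets_all [simp]: "A \<in> sets M \<longleftrightarrow> A \<subseteq> space M"
  using discrete by (auto simp: discrete_measure_space_def)

lemma emeasure_point_finite: "x \<in> space M \<Longrightarrow> emeasure M {x} < \<infinity>"
  and measure_point_pos: "x \<in> space M \<Longrightarrow> 0 < measure M {x}"
  using discrete
  by (auto simp: discrete_measure_space_def measure_def enn2real_positive_iff)

lemma finite_support_integrable:
  fixes f :: "'a \<Rightarrow> 'b::{banach, second_countable_topology}"
  assumes "finite F" "F \<subseteq> space M" "\<And>x. x \<in> space M \<Longrightarrow> x \<notin> F \<Longrightarrow> f x = 0"
  shows "has_bochner_integral M f (\<Sum>x\<in>F. measure M {x} *\<^sub>R f x)"
proof -
  have "has_bochner_integral M (\<lambda>y. \<Sum>x\<in>F. indicator {x} y *\<^sub>R f x) (\<Sum>x\<in>F. measure M {x} *\<^sub>R f x)"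
  proof (intro has_bochner_integral_sum)
    fix x assume "x \<in> F"
    then have "has_bochner_integral M (indicator {x} :: 'a \<Rightarrow> real) (measure M {x})"
      using assms(2) emeasure_point_finite by (intro has_bochner_integral_real_indicator) auto
    then show "has_bochner_integral M (\<lambda>y. indicator {x} y *\<^sub>R f x) (measure M {x} *\<^sub>R f x)"
      by (rule has_bochner_integral_scaleR_left)
  qed
  moreover have "(\<Sum>x\<in>F. indicator {x} y *\<^sub>R f x) = f y" if "y \<in> space M" for y
  proof -
    have "(\<Sum>x\<in>F. indicator {x} y *\<^sub>R f x) = (\<Sum>x\<in>F. if x = y then f x else 0)"
      by (intro sum.cong) (auto simp: indicator_def)
    then show ?thesis using assms that by (auto simp: sum.delta)
  qed
  ultimately show ?thesis by (simp cong: has_bochner_integral_cong)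
qed

lemma L2_iff: "f \<in> L2 M \<longleftrightarrow> integrable M (\<lambda>x. (cmod (f x))\<^sup>2) \<and> (\<forall>x. x \<notin> space M \<longrightarrow> f x = 0)"
  by (simp add: L2_def)

lemma L2_finite_support:
  assumes "finite F" "F \<subseteq> space M" "\<And>x. x \<notin> F \<Longrightarrow> f x = 0"
  shows "f \<in> L2 M"
  using finite_support_integrable[of F "\<lambda>x. (cmod (f x))\<^sup>2"] assms
  by (auto simp: L2_iff integrable.simps)

lemma L2_zero [simp]: "(\<lambda>x. 0) \<in> L2 M"
  by (simp add: L2_iff)

lemma L2_dominated:
  assumes "f \<in> L2 M" "\<And>x. x \<in> space M \<Longrightarrow> cmod (g x) \<le> C * cmod (f x)" "\<And>x. x \<notin> space M \<Longrightarrow> g x = 0"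
  shows "g \<in> L2 M"
proof -
  have "integrable M (\<lambda>x. C\<^sup>2 * (cmod (f x))\<^sup>2)" using assms(1) by (simp add: L2_iff)
  then have "integrable M (\<lambda>x. (cmod (g x))\<^sup>2)"
  proof (rule Bochner_Integration.integrable_bound)
    show "AE x in M. norm ((cmod (g x))\<^sup>2) \<le> norm (C\<^sup>2 * (cmod (f x))\<^sup>2)"
      using power_mono[OF assms(2) norm_ge_zero, of _ 2] by (intro AE_I2) (simp add: power_mult_distrib)
  qed simp
  with assms(3) show ?thesis by (simp add: L2_iff)
qed

lemma L2_scale [simp]: "f \<in> L2 M \<Longrightarrow> (\<lambda>x. c * f x) \<in> L2 M"
  by (rule L2_dominated[where C = "cmod c"]) (auto simp: norm_mult L2_iff)

lemma L2_add [simp]: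
  assumes "f \<in> L2 M" "g \<in> L2 M"
  shows "(\<lambda>x. f x + g x) \<in> L2 M"
proof -
  have "integrable M (\<lambda>x. 2 * (cmod (f x))\<^sup>2 + 2 * (cmod (g x))\<^sup>2)" using assms by (simp add: L2_iff)
  then have "integrable M (\<lambda>x. (cmod (f x + g x))\<^sup>2)"
  proof (rule Bochner_Integration.integrable_bound)
    have "(cmod (f x + g x))\<^sup>2 \<le> 2 * (cmod (f x))\<^sup>2 + 2 * (cmod (g x))\<^sup>2" for x
    proof -
      have "(cmod (f x + g x))\<^sup>2 \<le> (cmod (f x) + cmod (g x))\<^sup>2"
        by (intro power_mono norm_triangle_ineq) simp
      also have "\<dots> \<le> 2 * (cmod (f x))\<^sup>2 + 2 * (cmod (g x))\<^sup>2"
        using zero_le_power2[of "cmod (f x) - cmod (g x)"] by (simp add: power2_eq_square algebra_simps)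
      finally show ?thesis .
    qed
    then show "AE x in M. norm ((cmod (f x + g x))\<^sup>2) \<le> norm (2 * (cmod (f x))\<^sup>2 + 2 * (cmod (g x))\<^sup>2)"
      by (auto intro!: AE_I2 simp: abs_of_nonneg)
  qed simp
  with assms show ?thesis by (simp add: L2_iff)
qed

lemma L2_diff [simp]: "f \<in> L2 M \<Longrightarrow> g \<in> L2 M \<Longrightarrow> (\<lambda>x. f x - g x) \<in> L2 M"
  using L2_add[of f "\<lambda>x. -1 * g x"] L2_scale[of g "-1"] by simp

lemma L2_inner_integrable:
  assumes "f \<in> L2 M" "g \<in> L2 M"
  shows "integrable M (\<lambda>x. f x * cnj (g x))"
proof -
  have "integrable M (\<lambda>x. (cmod (f x))\<^sup>2 + (cmod (g x))\<^sup>2)" using assms by (simp add: L2_iff)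
  then show ?thesis
  proof (rule Bochner_Integration.integrable_bound)
    have "cmod (f x) * cmod (g x) \<le> (cmod (f x))\<^sup>2 + (cmod (g x))\<^sup>2" for x
      using sum_squares_bound[of "cmod (f x)" "cmod (g x)"] mult_nonneg_nonneg[OF norm_ge_zero norm_ge_zero, of "f x" "g x"]
      unfolding mult.assoc by linarith
    then show "AE x in M. norm (f x * cnj (g x)) \<le> norm ((cmod (f x))\<^sup>2 + (cmod (g x))\<^sup>2)"
      by (auto intro!: AE_I2 simp: norm_mult abs_of_nonneg)
  qed simp
qed

lemma L2_inner_add_left: "f \<in> L2 M \<Longrightarrow> g \<in> L2 M \<Longrightarrow> h \<in> L2 M \<Longrightarrow>
    L2_inner M (\<lambda>x. f x + g x) h = L2_inner M f h + L2_inner M g h"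
  unfolding L2_inner_def by (simp add: ring_distribs L2_inner_integrable)

lemma L2_inner_scale_left: "L2_inner M (\<lambda>x. c * f x) h = c * L2_inner M f h"
  unfolding L2_inner_def by (simp add: mult.assoc)

lemma L2_inner_commute: "L2_inner M g f = cnj (L2_inner M f g)"
proof -
  have "L2_inner M g f = (\<integral>x. cnj (f x * cnj (g x)) \<partial>M)"
    by (simp add: L2_inner_def mult.commute)
  then show ?thesis by (simp only: Bochner_Integration.integral_cnj L2_inner_def)
qed

lemma L2_inner_add_right: "f \<in> L2 M \<Longrightarrow> g \<in> L2 M \<Longrightarrow> h \<in> L2 M \<Longrightarrow>
    L2_inner M h (\<lambda>x. f x + g x) = L2_inner M h f + L2_inner M h g"
  by (subst (1 2 3) L2_inner_commute) (simp add: L2_inner_add_left)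

lemma L2_inner_scale_right: "L2_inner M h (\<lambda>x. c * f x) = cnj c * L2_inner M h f"
  by (subst (1 2) L2_inner_commute) (simp add: L2_inner_scale_left)

lemma L2_norm_nonneg [simp]: "0 \<le> L2_norm M f"
  by (simp add: L2_norm_def)

lemma L2_inner_self: "L2_inner M f f = of_real ((L2_norm M f)\<^sup>2)"
proof -
  have "L2_inner M f f = (\<integral>x. of_real ((cmod (f x))\<^sup>2) \<partial>M)"
    by (simp only: L2_inner_def complex_norm_square)
  then show ?thesis by (simp only: integral_complex_of_real) (simp add: L2_norm_def)
qed

lemma nn_integral_eq_L2_norm:
  assumes "f \<in> L2 M"
  shows "(\<integral>\<^sup>+x. (ennreal (cmod (f x)))\<^sup>2 \<partial>M) = ennreal ((L2_norm M f)\<^sup>2)"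
  using assms nn_integral_eq_integral[of M "\<lambda>x. (cmod (f x))\<^sup>2"]
  by (simp add: L2_iff L2_norm_def ennreal_power)

lemma L2_Cauchy_Schwarz:
  assumes "f \<in> L2 M" "g \<in> L2 M"
  shows "cmod (L2_inner M f g) \<le> L2_norm M f * L2_norm M g"
proof -
  have "ennreal (cmod (L2_inner M f g)) \<le> (\<integral>\<^sup>+x. cmod (f x * cnj (g x)) \<partial>M)"
    unfolding L2_inner_def by (rule integral_norm_bound_ennreal) (rule L2_inner_integrable[OF assms])
  also have "\<dots> = (\<integral>\<^sup>+x. ennreal (cmod (f x)) * ennreal (cmod (g x)) \<partial>M)"
    by (simp add: norm_mult ennreal_mult)
  finally have "(ennreal (cmod (L2_inner M f g)))\<^sup>2 \<le> \<dots>\<^sup>2" by (rule power_mono) simp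
  also have "\<dots> \<le> ennreal ((L2_norm M f)\<^sup>2) * ennreal ((L2_norm M g)\<^sup>2)"
    using Cauchy_Schwarz_nn_integral[of "\<lambda>x. ennreal (cmod (f x))" M "\<lambda>x. ennreal (cmod (g x))"]
    by (simp add: nn_integral_eq_L2_norm assms)
  finally have "(cmod (L2_inner M f g))\<^sup>2 \<le> (L2_norm M f * L2_norm M g)\<^sup>2"
    by (simp add: ennreal_power power_mult_distrib flip: ennreal_mult)
  then show ?thesis by (rule power2_le_imp_le) (simp add: L2_norm_def)
qed

lemma L2_norm_triangle:
  assumes "f \<in> L2 M" "g \<in> L2 M"
  shows "L2_norm M (\<lambda>x. f x + g x) \<le> L2_norm M f + L2_norm M g"
proof (rule power2_le_imp_le)
  let ?s = "\<lambda>x. f x + g x"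
  have "complex_of_real ((L2_norm M ?s)\<^sup>2) = L2_inner M f f + L2_inner M g g + (L2_inner M f g + cnj (L2_inner M f g))"
    using assms by (subst L2_inner_self[symmetric])
      (simp add: L2_inner_add_left L2_inner_add_right L2_inner_commute[of g f])
  also have "\<dots> = of_real ((L2_norm M f)\<^sup>2 + (L2_norm M g)\<^sup>2 + 2 * Re (L2_inner M f g))"
    by (simp add: L2_inner_self complex_add_cnj)
  finally have "(L2_norm M ?s)\<^sup>2 = (L2_norm M f)\<^sup>2 + (L2_norm M g)\<^sup>2 + 2 * Re (L2_inner M f g)"
    using of_real_eq_iff by blast
  moreover have "Re (L2_inner M f g) \<le> L2_norm M f * L2_norm M g"
    using L2_Cauchy_Schwarz[OF assms] complex_Re_le_cmod order_trans by blast
  ultimately show "(L2_norm M ?s)\<^sup>2 \<le> (L2_norm M f + L2_norm M g)\<^sup>2"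
    by (simp add: power2_sum)
qed simp

lemma L2_norm_scale: "L2_norm M (\<lambda>x. c * f x) = cmod c * L2_norm M f"
  by (simp add: L2_norm_def norm_mult power_mult_distrib real_sqrt_mult)

lemma L2_inner_finite_support:
  assumes "finite F" "F \<subseteq> space M" "\<And>x. x \<notin> F \<Longrightarrow> f x = 0"
  shows "L2_inner M g f = (\<Sum>x\<in>F. measure M {x} *\<^sub>R (g x * cnj (f x)))"
  unfolding L2_inner_def using assms
  by (intro has_bochner_integral_integral_eq finite_support_integrable) auto

definition delta :: "'a \<Rightarrow> 'a \<Rightarrow> complex" where
  "delta x = (\<lambda>y. if y = x then 1 else 0)"

lemma delta_L2 [simp]: "x \<in> space M \<Longrightarrow> delta x \<in> L2 M"
  by (rule L2_finite_support[of "{x}"]) (auto simp: delta_def)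

lemma L2_inner_delta: "x \<in> space M \<Longrightarrow> L2_inner M g (delta x) = of_real (measure M {x}) * g x"
  by (subst L2_inner_finite_support[of "{x}"]) (auto simp: delta_def scaleR_conv_of_real)

lemma L2_eqI:
  assumes "f \<in> L2 M" "g \<in> L2 M" "\<And>h. h \<in> L2 M \<Longrightarrow> L2_inner M f h = L2_inner M g h"
  shows "f = g"
proof
  fix x show "f x = g x"
  proof (cases "x \<in> space M")
    case True
    then show ?thesis using assms(3)[of "delta x"] measure_point_pos[of x] by (simp add: L2_inner_delta)
  qed (use assms in \<open>simp add: L2_iff\<close>)
qed

section \<open>Bounded operators and their adjoints\<close>

lemma bounded_opsI:
  assumes "\<And>f. f \<in> L2 M \<Longrightarrow> T f \<in> L2 M"
    and "\<And>f g. f \<in> L2 M \<Longrightarrow> g \<in> L2 M \<Longrightarrow> T (\<lambda>x. f x + g x) = (\<lambda>x. T f x + T g x)"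
    and "\<And>c f. f \<in> L2 M \<Longrightarrow> T (\<lambda>x. c * f x) = (\<lambda>x. c * T f x)"
    and "\<And>f. f \<in> L2 M \<Longrightarrow> L2_norm M (T f) \<le> K * L2_norm M f"
    and "\<And>f. f \<notin> L2 M \<Longrightarrow> T f = (\<lambda>x. 0)"
  shows "T \<in> bounded_ops M"
  unfolding bounded_ops_def using assms by blast

lemma bounded_op_add: "T \<in> bounded_ops M \<Longrightarrow> f \<in> L2 M \<Longrightarrow> g \<in> L2 M \<Longrightarrow> T (\<lambda>x. f x + g x) = (\<lambda>x. T f x + T g x)"
  and bounded_op_scale: "T \<in> bounded_ops M \<Longrightarrow> f \<in> L2 M \<Longrightarrow> T (\<lambda>x. c * f x) = (\<lambda>x. c * T f x)"
  and bounded_op_outside: "T \<in> bounded_ops M \<Longrightarrow> f \<notin> L2 M \<Longrightarrow> T f = (\<lambda>x. 0)"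
  by (simp_all add: bounded_ops_def)

lemma bounded_op_L2 [simp]: "T \<in> bounded_ops M \<Longrightarrow> T f \<in> L2 M"
  by (cases "f \<in> L2 M") (simp_all add: bounded_ops_def)

lemma bounded_op_zero [simp]: "T \<in> bounded_ops M \<Longrightarrow> T (\<lambda>x. 0) = (\<lambda>x. 0)"
  using bounded_op_scale[of T "\<lambda>x. 0" 0] by simp

lemma bounded_op_bound:
  assumes "T \<in> bounded_ops M"
  obtains K where "0 \<le> K" "\<And>f. f \<in> L2 M \<Longrightarrow> L2_norm M (T f) \<le> K * L2_norm M f"
proof -
  obtain K where K: "\<forall>f\<in>L2 M. L2_norm M (T f) \<le> K * L2_norm M f"
    using assms unfolding bounded_ops_def by blast
  have "L2_norm M (T f) \<le> \<bar>K\<bar> * L2_norm M f" if "f \<in> L2 M" for f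
    by (rule order_trans[OF K[rule_format, OF that]]) (simp add: mult_right_mono)
  then show thesis using that[of "\<bar>K\<bar>"] by simp
qed

text \<open>
  Truncation to the first \<open>n\<close> points of an enumeration of the space: finitely supported
  functions are dense, and identities between bounded operators may be checked on them.
\<close>

definition trunc :: "nat \<Rightarrow> ('a \<Rightarrow> complex) \<Rightarrow> 'a \<Rightarrow> complex" where
  "trunc n f = (\<lambda>x. if x \<in> space M \<and> to_nat_on (space M) x < n then f x else 0)"

lemma finite_trunc_support: "finite {x\<in>space M. to_nat_on (space M) x < n}"
proof -
  have "inj_on (to_nat_on (space M)) {x\<in>space M. to_nat_on (space M) x < n}"
    using discrete by (intro inj_on_subset[OF inj_on_to_nat_on]) (auto simp: discrete_measure_space_def)
  moreover have "to_nat_on (space M) ` {x\<in>space M. to_nat_on (space M) x < n} \<subseteq> {..<n}" by auto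
  ultimately show ?thesis by (meson finite_lessThan finite_subset finite_imageD)
qed

lemma trunc_L2 [simp]: "trunc n f \<in> L2 M"
  by (rule L2_finite_support[OF finite_trunc_support[of n]]) (auto simp: trunc_def)

lemma trunc_tendsto:
  assumes "f \<in> L2 M"
  shows "(\<lambda>n. L2_norm M (\<lambda>x. trunc n f x - f x)) \<longlonglongrightarrow> 0"
proof -
  have "(\<lambda>n. \<integral>x. (cmod (trunc n f x - f x))\<^sup>2 \<partial>M) \<longlonglongrightarrow> (\<integral>x. 0 \<partial>M)"
  proof (rule integral_dominated_convergence)
    show "integrable M (\<lambda>x. (cmod (f x))\<^sup>2)" using assms by (simp add: L2_iff)
    have "(\<lambda>n. (cmod (trunc n f x - f x))\<^sup>2) \<longlonglongrightarrow> 0" if "x \<in> space M" for x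
    proof (rule tendsto_eventually)
      show "\<forall>\<^sub>F n in sequentially. (cmod (trunc n f x - f x))\<^sup>2 = 0"
        using eventually_gt_at_top[of "to_nat_on (space M) x"]
        by eventually_elim (use that in \<open>simp add: trunc_def\<close>)
    qed
    then show "AE x in M. (\<lambda>n. (cmod (trunc n f x - f x))\<^sup>2) \<longlonglongrightarrow> 0" by auto
    show "AE x in M. norm ((cmod (trunc n f x - f x))\<^sup>2) \<le> (cmod (f x))\<^sup>2" for n
      by (intro AE_I2) (auto simp: trunc_def)
  qed simp_all
  then show ?thesis unfolding L2_norm_def using tendsto_real_sqrt by fastforce
qed

lemma trunc_inner_tendsto:
  assumes "f \<in> L2 M" "g \<in> L2 M" and T: "T \<in> bounded_ops M"
  shows "(\<lambda>n. L2_inner M (T (trunc n f)) g) \<longlonglongrightarrow> L2_inner M (T f) g"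
proof -
  obtain K where K: "\<And>f. f \<in> L2 M \<Longrightarrow> L2_norm M (T f) \<le> K * L2_norm M f"
    using T bounded_op_bound by metis
  have "cmod (L2_inner M (T (trunc n f)) g - L2_inner M (T f) g)
        \<le> K * L2_norm M (\<lambda>x. trunc n f x - f x) * L2_norm M g" for n
  proof -
    let ?d = "\<lambda>x. trunc n f x - f x"
    have d: "?d \<in> L2 M" "T ?d \<in> L2 M" "T f \<in> L2 M" using assms by simp_all
    have "T (\<lambda>x. f x + ?d x) = (\<lambda>x. T f x + T ?d x)"
      by (rule bounded_op_add[OF T assms(1) d(1)])
    then have "L2_inner M (T (trunc n f)) g - L2_inner M (T f) g = L2_inner M (T ?d) g"
      using d assms by (simp add: L2_inner_add_left)
    also have "cmod \<dots> \<le> L2_norm M (T ?d) * L2_norm M g" using d assms by (intro L2_Cauchy_Schwarz)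
    also have "\<dots> \<le> K * L2_norm M ?d * L2_norm M g" using K[OF d(1)] by (intro mult_right_mono) auto
    finally show ?thesis .
  qed
  moreover have "(\<lambda>n. K * L2_norm M (\<lambda>x. trunc n f x - f x) * L2_norm M g) \<longlonglongrightarrow> 0"
    by (intro tendsto_mult_left_zero tendsto_mult_right_zero trunc_tendsto assms(1))
  ultimately have "(\<lambda>n. L2_inner M (T (trunc n f)) g - L2_inner M (T f) g) \<longlonglongrightarrow> 0"
    by - (rule Lim_null_comparison[OF always_eventually[OF allI]])
  then show ?thesis by (simp add: LIM_zero_iff)
qed

lemma bounded_op_ext:
  assumes "S \<in> bounded_ops M" "T \<in> bounded_ops M" "\<And>f. f \<in> L2 M \<Longrightarrow> S f = T f"
  shows "S = T"
proof
  fix f show "S f = T f"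
    using assms bounded_op_outside[of S f] bounded_op_outside[of T f] by (cases "f \<in> L2 M") simp_all
qed

lemma bounded_op_comp [simp]:
  assumes S: "S \<in> bounded_ops M" and T: "T \<in> bounded_ops M"
  shows "S \<circ> T \<in> bounded_ops M"
proof -
  obtain K where K: "0 \<le> K" "\<And>f. f \<in> L2 M \<Longrightarrow> L2_norm M (S f) \<le> K * L2_norm M f"
    using S bounded_op_bound by blast
  obtain L where L: "0 \<le> L" "\<And>f. f \<in> L2 M \<Longrightarrow> L2_norm M (T f) \<le> L * L2_norm M f"
    using T bounded_op_bound by blast
  show ?thesis
  proof (rule bounded_opsI[where K = "K * L"])
    fix f assume f: "f \<in> L2 M"
    have "L2_norm M (S (T f)) \<le> K * L2_norm M (T f)" using K T f by simp
    also have "\<dots> \<le> K * (L * L2_norm M f)" using L f K by (intro mult_left_mono) auto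
    finally show "L2_norm M ((S \<circ> T) f) \<le> K * L * L2_norm M f" by (simp add: mult.assoc)
  qed (simp_all add: S T bounded_op_add[OF S] bounded_op_add[OF T] bounded_op_scale[OF S] bounded_op_scale[OF T] bounded_op_outside[OF T])
qed

lemma bounded_op_plus [simp]:
  assumes S: "S \<in> bounded_ops M" and T: "T \<in> bounded_ops M"
  shows "(\<lambda>f x. S f x + T f x) \<in> bounded_ops M"
proof -
  obtain K where K: "\<And>f. f \<in> L2 M \<Longrightarrow> L2_norm M (S f) \<le> K * L2_norm M f"
    using S bounded_op_bound by blast
  obtain L where L: "\<And>f. f \<in> L2 M \<Longrightarrow> L2_norm M (T f) \<le> L * L2_norm M f"
    using T bounded_op_bound by blast
  show ?thesis
  proof (rule bounded_opsI[where K = "K + L"])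
    fix f assume f: "f \<in> L2 M"
    have "L2_norm M (\<lambda>x. S f x + T f x) \<le> L2_norm M (S f) + L2_norm M (T f)"
      using S T by (intro L2_norm_triangle) simp_all
    also have "\<dots> \<le> (K + L) * L2_norm M f" using K[OF f] L[OF f] by (simp add: distrib_right)
    finally show "L2_norm M (\<lambda>x. S f x + T f x) \<le> (K + L) * L2_norm M f" .
  qed (simp_all add: S T bounded_op_add[OF S] bounded_op_add[OF T] bounded_op_scale[OF S] bounded_op_scale[OF T]
      bounded_op_outside[OF S] bounded_op_outside[OF T] algebra_simps)
qed

lemma bounded_op_times [simp]:
  assumes T: "T \<in> bounded_ops M"
  shows "(\<lambda>f x. c * T f x) \<in> bounded_ops M"
proof -
  obtain L where L: "\<And>f. f \<in> L2 M \<Longrightarrow> L2_norm M (T f) \<le> L * L2_norm M f"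
    using T bounded_op_bound by blast
  show ?thesis
  proof (rule bounded_opsI[where K = "cmod c * L"])
    fix f assume f: "f \<in> L2 M"
    show "L2_norm M (\<lambda>x. c * T f x) \<le> cmod c * L * L2_norm M f"
      using mult_left_mono[OF L[OF f], of "cmod c"] by (simp add: L2_norm_scale mult.assoc)
  qed (simp_all add: T bounded_op_add[OF T] bounded_op_scale[OF T] bounded_op_outside[OF T] algebra_simps)
qed

lemma bounded_op_zero_op [simp]: "(\<lambda>f x. 0) \<in> bounded_ops M"
  by (rule bounded_opsI[where K = 0]) (simp_all add: L2_norm_def)

lemma bounded_op_id [simp]: "id_op M \<in> bounded_ops M"
  by (rule bounded_opsI[where K = 1]) (simp_all add: id_op_def)

lemma id_op_comp [simp]: "T \<in> bounded_ops M \<Longrightarrow> id_op M \<circ> T = T"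
  by (rule ext) (simp add: id_op_def)

lemma comp_id_op [simp]: "T \<in> bounded_ops M \<Longrightarrow> T \<circ> id_op M = T"
  by (rule ext) (simp add: id_op_def bounded_op_outside[of T])

lemma bounded_op_projection: "mult_op M (indicator E) \<in> bounded_ops M"
proof (rule bounded_opsI[where K = 1])
  fix f assume f: "f \<in> L2 M"
  then show g: "mult_op M (indicator E) f \<in> L2 M"
    by (intro L2_dominated[OF f, of _ 1]) (auto simp: mult_op_def indicator_def L2_iff)
  show "L2_norm M (mult_op M (indicator E) f) \<le> 1 * L2_norm M f"
    unfolding L2_norm_def mult_1_left real_sqrt_le_iff
    by (rule integral_mono) (use f g in \<open>auto simp: L2_iff mult_op_def indicator_def\<close>)
qed (auto simp: mult_op_def algebra_simps)

text \<open>
  The adjoint is forced by its values at points: testing against the indicator of \<open>x\<close> gives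
  \<open>(T\<^sup>* g) x = \<langle>g, T \<delta>\<^sub>x\<rangle> / \<mu>{x}\<close>. The function \<open>T\<^sup>* g\<close> is square-integrable because a truncation \<open>h\<close> of
  it satisfies \<open>\<parallel>h\<parallel>\<^sup>2 = \<langle>g, T h\<rangle> \<le> \<parallel>g\<parallel> K \<parallel>h\<parallel>\<close>, so that \<open>\<parallel>h\<parallel> \<le> K \<parallel>g\<parallel>\<close> uniformly; the defining
  identity then extends from finitely supported functions by continuity.
\<close>

lemma adjoint_exists:
  assumes T: "T \<in> bounded_ops M"
  shows "\<exists>S \<in> bounded_ops M. \<forall>f\<in>L2 M. \<forall>g\<in>L2 M. L2_inner M (T f) g = L2_inner M f (S g)"
proof -
  obtain K where K: "0 \<le> K" "\<And>f. f \<in> L2 M \<Longrightarrow> L2_norm M (T f) \<le> K * L2_norm M f"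
    using T bounded_op_bound by blast
  define S where "S g = (\<lambda>x. if g \<in> L2 M \<and> x \<in> space M
      then L2_inner M g (T (delta x)) / of_real (measure M {x}) else 0)" for g
  have finite_adjoint: "L2_inner M g (T f) = (\<Sum>x\<in>F. measure M {x} *\<^sub>R (S g x * cnj (f x)))"
    if g: "g \<in> L2 M" and "finite F" "F \<subseteq> space M" "\<And>x. x \<notin> F \<Longrightarrow> f x = 0" for f g F
    using that(2-)
  proof (induction F arbitrary: f)
    case empty
    then have "f = (\<lambda>x. 0)" by auto
    then show ?case using T by (simp add: L2_inner_def)
  next
    case (insert x F)
    let ?f = "f(x := 0)"
    have f': "?f \<in> L2 M" using insert by (intro L2_finite_support[of F]) auto
    have d: "delta x \<in> L2 M" using insert by simp
    have "f = (\<lambda>y. ?f y + f x * delta x y)" by (auto simp: delta_def)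
    then have "T f = (\<lambda>y. T ?f y + f x * T (delta x) y)"
      using bounded_op_add[OF T f' L2_scale[OF d, of "f x"]] bounded_op_scale[OF T d] by simp
    then have "L2_inner M g (T f) = L2_inner M g (T ?f) + cnj (f x) * L2_inner M g (T (delta x))"
      using g T by (simp add: L2_inner_add_right L2_inner_scale_right)
    moreover have "L2_inner M g (T (delta x)) = measure M {x} *\<^sub>R S g x"
      using insert g measure_point_pos[of x] by (simp add: S_def scaleR_conv_of_real)
    moreover have "L2_inner M g (T ?f) = (\<Sum>y\<in>F. measure M {y} *\<^sub>R (S g y * cnj (?f y)))"
      using insert by (intro insert.IH) auto
    moreover have "\<dots> = (\<Sum>y\<in>F. measure M {y} *\<^sub>R (S g y * cnj (f y)))"
      using insert by (intro sum.cong) auto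
    ultimately show ?case using insert by (simp add: mult.commute)
  qed
  have trunc_adjoint: "L2_inner M g (T (trunc n f)) = L2_inner M (S g) (trunc n f)"
    if "g \<in> L2 M" for f g n
  proof -
    have supp: "trunc n f x = 0" if "x \<notin> {x \<in> space M. to_nat_on (space M) x < n}" for x
      using that by (auto simp: trunc_def)
    show ?thesis
      using finite_adjoint[OF that finite_trunc_support[of n], of "trunc n f"]
        L2_inner_finite_support[OF finite_trunc_support[of n], of "trunc n f" "S g"] supp by auto
  qed
  have trunc_bound: "L2_norm M (trunc n (S g)) \<le> K * L2_norm M g" if g: "g \<in> L2 M" for g n
  proof -
    let ?h = "trunc n (S g)"
    have "L2_inner M ?h ?h = L2_inner M (S g) ?h"
      unfolding L2_inner_def by (intro Bochner_Integration.integral_cong) (auto simp: trunc_def)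
    then have "cmod (L2_inner M ?h ?h) = cmod (L2_inner M g (T ?h))"
      using trunc_adjoint[OF g] by simp
    also have "\<dots> \<le> L2_norm M g * L2_norm M (T ?h)" using g T by (intro L2_Cauchy_Schwarz) auto
    also have "\<dots> \<le> L2_norm M g * (K * L2_norm M ?h)" using K by (intro mult_left_mono) auto
    finally have "L2_norm M ?h * L2_norm M ?h \<le> (K * L2_norm M g) * L2_norm M ?h"
      by (simp add: L2_inner_self power2_eq_square algebra_simps norm_mult)
    then show ?thesis
      using K by (cases "L2_norm M ?h = 0") (auto simp: mult_le_cancel_right order_less_le)
  qed
  have nn: "(\<integral>\<^sup>+x. (ennreal (cmod (S g x)))\<^sup>2 \<partial>M) \<le> ennreal ((K * L2_norm M g)\<^sup>2)" if g: "g \<in> L2 M" for g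
  proof (rule LIMSEQ_le_const2)
    show "(\<lambda>n. \<integral>\<^sup>+x. (ennreal (cmod (trunc n (S g) x)))\<^sup>2 \<partial>M) \<longlonglongrightarrow> (\<integral>\<^sup>+x. (ennreal (cmod (S g x)))\<^sup>2 \<partial>M)"
    proof (rule nn_integral_LIMSEQ)
      show "incseq (\<lambda>n x. (ennreal (cmod (trunc n (S g) x)))\<^sup>2)"
        by (auto simp: incseq_def le_fun_def trunc_def)
      fix x
      have "\<forall>\<^sub>F n in sequentially. (ennreal (cmod (trunc n (S g) x)))\<^sup>2 = (ennreal (cmod (S g x)))\<^sup>2"
        using eventually_gt_at_top[of "to_nat_on (space M) x"]
        by eventually_elim (auto simp: trunc_def S_def)
      then show "(\<lambda>n. (ennreal (cmod (trunc n (S g) x)))\<^sup>2) \<longlonglongrightarrow> (ennreal (cmod (S g x)))\<^sup>2"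
        by (rule tendsto_eventually)
    qed auto
    have "(\<integral>\<^sup>+x. (ennreal (cmod (trunc n (S g) x)))\<^sup>2 \<partial>M) \<le> ennreal ((K * L2_norm M g)\<^sup>2)" for n
      using trunc_bound[OF g, of n] by (subst nn_integral_eq_L2_norm) (auto intro!: ennreal_leI power_mono)
    then show "\<exists>N. \<forall>n\<ge>N. (\<integral>\<^sup>+x. (ennreal (cmod (trunc n (S g) x)))\<^sup>2 \<partial>M) \<le> ennreal ((K * L2_norm M g)\<^sup>2)"
      by blast
  qed
  have S_L2: "S g \<in> L2 M" for g
  proof (cases "g \<in> L2 M")
    case True
    have "(\<integral>\<^sup>+x. ennreal (norm ((cmod (S g x))\<^sup>2)) \<partial>M) < \<infinity>"
      using nn[OF True] by (auto simp: ennreal_power le_less_trans ennreal_less_top)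
    then have "integrable M (\<lambda>x. (cmod (S g x))\<^sup>2)" by (intro integrableI_bounded) auto
    then show ?thesis by (auto simp: L2_iff S_def)
  qed (simp add: S_def)
  show ?thesis
  proof (intro bexI ballI)
    fix f g assume f: "f \<in> L2 M" and g: "g \<in> L2 M"
    have "(\<lambda>n. L2_inner M (T (trunc n f)) g) \<longlonglongrightarrow> L2_inner M (T f) g"
      by (rule trunc_inner_tendsto[OF f g T])
    moreover have "(\<lambda>n. L2_inner M (id_op M (trunc n f)) (S g)) \<longlonglongrightarrow> L2_inner M (id_op M f) (S g)"
      by (rule trunc_inner_tendsto[OF f S_L2 bounded_op_id])
    moreover have "L2_inner M (T (trunc n f)) g = L2_inner M (id_op M (trunc n f)) (S g)" for n
      using trunc_adjoint[OF g, of n f] by (subst (1 2) L2_inner_commute) (simp add: id_op_def)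
    ultimately show "L2_inner M (T f) g = L2_inner M f (S g)"
      using f by (auto simp: id_op_def intro: LIMSEQ_unique)
  next
    show "S \<in> bounded_ops M"
    proof (rule bounded_opsI[where K = K])
      fix g assume g: "g \<in> L2 M"
      have "ennreal ((L2_norm M (S g))\<^sup>2) \<le> ennreal ((K * L2_norm M g)\<^sup>2)"
        using nn[OF g] by (simp add: nn_integral_eq_L2_norm S_L2)
      then have "(L2_norm M (S g))\<^sup>2 \<le> (K * L2_norm M g)\<^sup>2" by simp
      then show "L2_norm M (S g) \<le> K * L2_norm M g"
        by (rule power2_le_imp_le) (use K in simp)
    next
      fix f g assume "f \<in> L2 M" "g \<in> L2 M"
      then show "S (\<lambda>x. f x + g x) = (\<lambda>x. S f x + S g x)"
        using T by (auto simp: S_def L2_inner_add_left add_divide_distrib)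
    qed (auto simp: S_L2, auto simp: S_def L2_inner_scale_left)
  qed
qed

lemma adj_eqI:
  assumes "S \<in> bounded_ops M"
    and "\<And>f g. f \<in> L2 M \<Longrightarrow> g \<in> L2 M \<Longrightarrow> L2_inner M (T f) g = L2_inner M f (S g)"
  shows "adj M T = S"
  unfolding adj_def
proof (rule the_equality)
  fix S' assume S': "S' \<in> bounded_ops M \<and>
      (\<forall>f\<in>L2 M. \<forall>g\<in>L2 M. L2_inner M (T f) g = L2_inner M f (S' g))"
  then have S'_bop: "S' \<in> bounded_ops M" ..
  show "S' = S"
  proof (rule bounded_op_ext)
    fix g assume g: "g \<in> L2 M"
    show "S' g = S g"
    proof (rule L2_eqI)
      fix h assume "h \<in> L2 M"
      then have "L2_inner M h (S' g) = L2_inner M h (S g)" using S' g assms(2) by metis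
      then show "L2_inner M (S' g) h = L2_inner M (S g) h" by (subst (1 2) L2_inner_commute) simp
    qed (simp_all add: S'_bop assms(1))
  qed (simp_all add: S'_bop assms(1))
next
  show "S \<in> bounded_ops M \<and> (\<forall>f\<in>L2 M. \<forall>g\<in>L2 M. L2_inner M (T f) g = L2_inner M f (S g))"
    by (intro conjI ballI assms)
qed

lemma adj_spec:
  assumes "T \<in> bounded_ops M"
  shows "adj M T \<in> bounded_ops M \<and>
    (\<forall>f\<in>L2 M. \<forall>g\<in>L2 M. L2_inner M (T f) g = L2_inner M f (adj M T g))"
proof -
  obtain S where S: "S \<in> bounded_ops M"
      "\<forall>f\<in>L2 M. \<forall>g\<in>L2 M. L2_inner M (T f) g = L2_inner M f (S g)"
    using adjoint_exists[OF assms] by blast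
  then have "adj M T = S" by (intro adj_eqI[OF S(1)] S(2)[rule_format])
  with S show ?thesis by (simp only: simp_thms)
qed

lemmas adj_bounded_op [simp] = adj_spec[THEN conjunct1]
lemmas adj_inner = adj_spec[THEN conjunct2, rule_format]

lemma adj_inner':
  assumes "T \<in> bounded_ops M" "f \<in> L2 M" "g \<in> L2 M"
  shows "L2_inner M (adj M T f) g = L2_inner M f (T g)"
  using adj_inner[OF assms(1,3,2)] by (subst (1 2) L2_inner_commute) simp

lemma adj_adj [simp]: "T \<in> bounded_ops M \<Longrightarrow> adj M (adj M T) = T"
  by (rule adj_eqI) (simp_all add: adj_inner'[of T])

lemma adj_comp: "S \<in> bounded_ops M \<Longrightarrow> T \<in> bounded_ops M \<Longrightarrow> adj M (S \<circ> T) = adj M T \<circ> adj M S"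
  by (rule adj_eqI) (simp_all add: adj_inner[of S] adj_inner[of T])

lemma adj_plus: "S \<in> bounded_ops M \<Longrightarrow> T \<in> bounded_ops M \<Longrightarrow>
    adj M (\<lambda>f x. S f x + T f x) = (\<lambda>f x. adj M S f x + adj M T f x)"
  by (rule adj_eqI) (simp_all add: adj_inner[of S] adj_inner[of T] L2_inner_add_left L2_inner_add_right)

lemma adj_times: "T \<in> bounded_ops M \<Longrightarrow>
    adj M (\<lambda>f x. c * T f x) = (\<lambda>f x. cnj c * adj M T f x)"
  by (rule adj_eqI) (simp_all add: adj_inner[of T] L2_inner_scale_left L2_inner_scale_right)

lemma adj_id [simp]: "adj M (id_op M) = id_op M"
  by (rule adj_eqI[OF bounded_op_id]) (simp add: id_op_def)

lemma adj_projection: "adj M (mult_op M (indicator E)) = mult_op M (indicator E)"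
proof (rule adj_eqI[OF bounded_op_projection])
  fix f g assume "f \<in> L2 M" "g \<in> L2 M"
  then show "L2_inner M (mult_op M (indicator E) f) g = L2_inner M f (mult_op M (indicator E) g)"
    unfolding L2_inner_def mult_op_def
    by (intro Bochner_Integration.integral_cong) (auto simp: indicator_def)
qed

section \<open>Commutants and maximal commuting sets\<close>

definition commutant :: "'a operator set \<Rightarrow> 'a operator set" where
  "commutant \<S> = {T \<in> bounded_ops M. \<forall>X\<in>\<S>. T \<circ> X = X \<circ> T}"

lemma commutant_bounded_op: "T \<in> commutant \<S> \<Longrightarrow> T \<in> bounded_ops M"
  by (simp add: commutant_def)

lemma commutant_apply: "T \<in> commutant \<S> \<Longrightarrow> X \<in> \<S> \<Longrightarrow> T (X f) = X (T f)"
  by (auto simp: commutant_def fun_eq_iff)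

lemma commutantI:
  assumes "T \<in> bounded_ops M" "\<S> \<subseteq> bounded_ops M"
    and "\<And>X f. X \<in> \<S> \<Longrightarrow> f \<in> L2 M \<Longrightarrow> T (X f) = X (T f)"
  shows "T \<in> commutant \<S>"
proof -
  have "T \<circ> X = X \<circ> T" if "X \<in> \<S>" for X
    using that assms by (intro bounded_op_ext) auto
  then show ?thesis using assms(1) by (simp add: commutant_def)
qed

lemma commutant_antimono: "\<S> \<subseteq> \<T> \<Longrightarrow> commutant \<T> \<subseteq> commutant \<S>"
  by (auto simp: commutant_def)

lemma commutant_subalgebra:
  assumes "\<S> \<subseteq> bounded_ops M"
  shows "op_subalgebra M (commutant \<S>)"
proof -
  have "(\<lambda>f x. 0) \<in> commutant \<S>"
    using assms by (intro commutantI) auto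
  moreover have "(\<lambda>f x. S f x + T f x) \<in> commutant \<S>"
    if "S \<in> commutant \<S>" "T \<in> commutant \<S>" for S T
  proof (rule commutantI)
    fix X f assume X: "X \<in> \<S>"
    then have "X (\<lambda>x. S f x + T f x) = (\<lambda>x. X (S f) x + X (T f) x)"
      using that assms by (intro bounded_op_add) (auto simp: commutant_bounded_op)
    then show "(\<lambda>x. S (X f) x + T (X f) x) = X (\<lambda>x. S f x + T f x)"
      by (simp add: commutant_apply[OF that(1) X] commutant_apply[OF that(2) X])
  qed (use that assms in \<open>simp_all add: commutant_bounded_op\<close>)
  moreover have "(\<lambda>f x. c * T f x) \<in> commutant \<S>" if "T \<in> commutant \<S>" for c T
  proof (rule commutantI)
    fix X f assume X: "X \<in> \<S>"
    then have "X (\<lambda>x. c * T f x) = (\<lambda>x. c * X (T f) x)"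
      using that assms by (intro bounded_op_scale) (auto simp: commutant_bounded_op)
    then show "(\<lambda>x. c * T (X f) x) = X (\<lambda>x. c * T f x)"
      by (simp add: commutant_apply[OF that X])
  qed (use that assms in \<open>simp_all add: commutant_bounded_op\<close>)
  moreover have "S \<circ> T \<in> commutant \<S>" if "S \<in> commutant \<S>" "T \<in> commutant \<S>" for S T
    using that assms by (intro commutantI) (auto simp: commutant_bounded_op commutant_apply)
  ultimately show ?thesis
    unfolding op_subalgebra_def by (auto simp: commutant_bounded_op)
qed

lemma commutant_self_adjoint:
  assumes "\<S> \<subseteq> bounded_ops M" "self_adjoint_set M \<S>"
  shows "self_adjoint_set M (commutant \<S>)"
  unfolding self_adjoint_set_def
proof
  fix T assume T: "T \<in> commutant \<S>"
  have "adj M T \<circ> X = X \<circ> adj M T" if X: "X \<in> \<S>" for X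
  proof -
    have X': "adj M X \<in> \<S>" "X \<in> bounded_ops M" "T \<in> bounded_ops M"
      using X T assms by (auto simp: self_adjoint_set_def commutant_bounded_op)
    then have "adj M (T \<circ> adj M X) = adj M (adj M X \<circ> T)"
      using T by (simp add: commutant_def)
    then show ?thesis using X' by (simp add: adj_comp)
  qed
  then show "adj M T \<in> commutant \<S>"
    using commutant_bounded_op[OF T] by (simp add: commutant_def)
qed

text \<open>
  Any commutative algebra that contains \<open>\<B>\<close> lies in the commutant of \<open>\<B>\<close>, and a commutant is
  an algebra.
\<close>

lemma masa_if_own_commutant:
  assumes "\<B> = commutant \<B>" "self_adjoint_set M \<B>"
  shows "masa M \<B>"
proof -
  have "\<B> \<subseteq> bounded_ops M" using assms(1) commutant_bounded_op by blast
  then have "op_subalgebra M \<B>" using commutant_subalgebra[of \<B>] assms(1) by simp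
  moreover have "S \<circ> T = T \<circ> S" if "S \<in> \<B>" "T \<in> \<B>" for S T
    using that assms(1) by (auto simp: commutant_def)
  moreover have "\<C> \<subseteq> commutant \<B>" if "abelian_self_adjoint_algebra M \<C>" "\<B> \<subseteq> \<C>" for \<C>
    using that by (auto simp: abelian_self_adjoint_algebra_def op_subalgebra_def commutant_def)
  ultimately show ?thesis
    using assms unfolding masa_def abelian_self_adjoint_algebra_def[of M \<B>] by blast
qed

text \<open>
  The operators are \<open>T + T\<^sup>*\<close> and \<open>\<i> (T - T\<^sup>*)\<close>. They reduce questions about \<open>T\<close> to self-adjoint
  operators, which can be added to a self-adjoint set one at a time.
\<close>

lemma cartesian_decomposition:
  assumes T: "T \<in> bounded_ops M"
  obtains A B where "A \<in> bounded_ops M" "B \<in> bounded_ops M" "adj M A = A" "adj M B = B"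
    and "\<And>\<A>. op_subalgebra M \<A> \<Longrightarrow> T \<in> \<A> \<Longrightarrow> adj M T \<in> \<A> \<Longrightarrow> A \<in> \<A> \<and> B \<in> \<A>"
    and "\<And>\<A>. op_subalgebra M \<A> \<Longrightarrow> A \<in> \<A> \<Longrightarrow> B \<in> \<A> \<Longrightarrow> T \<in> \<A>"
proof -
  define A where "A = (\<lambda>f x. T f x + adj M T f x)"
  define B where "B = (\<lambda>f x. \<i> * T f x + - \<i> * adj M T f x)"
  show thesis
  proof (rule that)
    show "A \<in> bounded_ops M" "B \<in> bounded_ops M"
      unfolding A_def B_def using T by (intro bounded_op_plus bounded_op_times adj_bounded_op; assumption)+
    show "adj M A = A"
      unfolding A_def using T by (subst adj_plus) (simp_all add: add.commute)
    show "adj M B = B"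
      unfolding B_def
      by (simp only: adj_plus[OF bounded_op_times[OF T] bounded_op_times[OF adj_bounded_op[OF T]]] adj_times[OF T]
          adj_times[OF adj_bounded_op[OF T]] adj_adj[OF T] complex_cnj_minus complex_cnj_i minus_minus add.commute)
    fix \<A> assume alg: "op_subalgebra M \<A>"
    have plus: "(\<lambda>f x. S f x + R f x) \<in> \<A>" if "S \<in> \<A>" "R \<in> \<A>" for S R
      using alg that by (simp add: op_subalgebra_def)
    have times: "(\<lambda>f x. c * S f x) \<in> \<A>" if "S \<in> \<A>" for c S
      using alg that by (simp add: op_subalgebra_def)
    show "A \<in> \<A> \<and> B \<in> \<A>" if "T \<in> \<A>" "adj M T \<in> \<A>"
      unfolding A_def B_def using that by (intro conjI plus times)
    show "T \<in> \<A>" if "A \<in> \<A>" "B \<in> \<A>"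
    proof -
      have "T = (\<lambda>f x. (1/2) * A f x + (- \<i>/2) * B f x)"
        by (auto simp: fun_eq_iff A_def B_def algebra_simps)
      also have "\<dots> \<in> \<A>" by (intro plus times that)
      finally show ?thesis .
    qed
  qed
qed

text \<open>
  A maximal commuting self-adjoint set \<open>\<C>\<close> contains every self-adjoint operator of its
  commutant. Through the Cartesian decomposition, its commutant is then itself commutative,
  and maximality gives equality. Maximality among sets rather than algebras keeps
  the adjunction of a single operator trivial.
\<close>

lemma self_commutant_extension:
  assumes "\<S> \<subseteq> commutant \<S>" "self_adjoint_set M \<S>"
  obtains \<C> where "\<S> \<subseteq> \<C>" "\<C> = commutant \<C>" "self_adjoint_set M \<C>"
proof -
  let ?Z = "{\<C>. \<S> \<subseteq> \<C> \<and> \<C> \<subseteq> commutant \<C> \<and> self_adjoint_set M \<C>}"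
  have "\<exists>\<C>\<in>?Z. \<forall>\<D>\<in>?Z. \<C> \<subseteq> \<D> \<longrightarrow> \<D> = \<C>"
  proof (rule subset_Zorn_nonempty)
    show "?Z \<noteq> {}" using assms by blast
    fix \<K> assume "\<K> \<noteq> {}" and chain: "subset.chain ?Z \<K>"
    then have K: "\<C> \<in> ?Z" if "\<C> \<in> \<K>" for \<C>
      using that unfolding subset_chain_def by blast
    have "\<Union>\<K> \<subseteq> commutant (\<Union>\<K>)"
    proof
      fix T assume "T \<in> \<Union>\<K>"
      then obtain \<C> where C: "\<C> \<in> \<K>" "T \<in> \<C>" by blast
      have "T \<circ> X = X \<circ> T" if "\<D> \<in> \<K>" "X \<in> \<D>" for \<D> X
      proof -
        have "\<C> \<subseteq> \<D> \<or> \<D> \<subseteq> \<C>" using chain C that by (auto simp: subset_chain_def)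
        moreover have "\<C> \<subseteq> commutant \<C>" "\<D> \<subseteq> commutant \<D>"
          using K[OF C(1)] K[OF that(1)] by simp_all
        ultimately show ?thesis using C that unfolding commutant_def by blast
      qed
      moreover have "T \<in> bounded_ops M"
        using K[OF C(1)] C(2) commutant_bounded_op by blast
      ultimately show "T \<in> commutant (\<Union>\<K>)" by (auto simp: commutant_def)
    qed
    moreover have "\<S> \<subseteq> \<Union>\<K>" "self_adjoint_set M (\<Union>\<K>)"
      using \<open>\<K> \<noteq> {}\<close> K by (blast, unfold self_adjoint_set_def) blast
    ultimately show "\<Union>\<K> \<in> ?Z" by blast
  qed
  then obtain \<C> where C_Z: "\<C> \<in> ?Z" and max_Z: "\<forall>\<D>\<in>?Z. \<C> \<subseteq> \<D> \<longrightarrow> \<D> = \<C>" by (rule bexE)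
  have C: "\<S> \<subseteq> \<C>" "\<C> \<subseteq> commutant \<C>" "self_adjoint_set M \<C>"
    using C_Z by simp_all
  have maxC: "\<D> = \<C>"
    if "\<S> \<subseteq> \<D>" "\<D> \<subseteq> commutant \<D>" "self_adjoint_set M \<D>" "\<C> \<subseteq> \<D>" for \<D>
    using max_Z that by simp
  have C_bop: "\<C> \<subseteq> bounded_ops M" using C(2) commutant_bounded_op by blast
  have sa: "self_adjoint_set M (commutant \<C>)" using commutant_self_adjoint[OF C_bop C(3)] .
  have hermitian: "A \<in> \<C>" if "A \<in> commutant \<C>" "adj M A = A" for A
  proof -
    have "insert A \<C> = \<C>"
    proof (rule maxC)
      show "insert A \<C> \<subseteq> commutant (insert A \<C>)"
        using C(2) that(1) unfolding commutant_def by auto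
      show "self_adjoint_set M (insert A \<C>)"
        using C(3) that(2) by (auto simp: self_adjoint_set_def)
    qed (use C(1) in auto)
    then show ?thesis by blast
  qed
  have "S \<circ> T = T \<circ> S" if S: "S \<in> commutant \<C>" and T: "T \<in> commutant \<C>" for S T
  proof (rule cartesian_decomposition[OF commutant_bounded_op[OF T]])
    fix A B assume "A \<in> bounded_ops M" "B \<in> bounded_ops M" and AB: "adj M A = A" "adj M B = B"
      and AB_T: "\<And>\<A>. op_subalgebra M \<A> \<Longrightarrow> T \<in> \<A> \<Longrightarrow> adj M T \<in> \<A> \<Longrightarrow> A \<in> \<A> \<and> B \<in> \<A>"
      and T_AB: "\<And>\<A>. op_subalgebra M \<A> \<Longrightarrow> A \<in> \<A> \<Longrightarrow> B \<in> \<A> \<Longrightarrow> T \<in> \<A>"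
    have "adj M T \<in> commutant \<C>" using sa T by (simp add: self_adjoint_set_def)
    then have "A \<in> commutant \<C>" "B \<in> commutant \<C>"
      using AB_T[OF commutant_subalgebra[OF C_bop] T] by simp_all
    with AB have "A \<in> \<C>" "B \<in> \<C>" by (simp_all add: hermitian)
    then have "A \<circ> S = S \<circ> A" "B \<circ> S = S \<circ> B" using S by (simp_all add: commutant_def)
    then have "A \<in> commutant {S}" "B \<in> commutant {S}"
      using \<open>A \<in> bounded_ops M\<close> \<open>B \<in> bounded_ops M\<close> by (simp_all add: commutant_def)
    then have "T \<in> commutant {S}"
      using T_AB[OF commutant_subalgebra] commutant_bounded_op[OF S] by simp
    then show ?thesis unfolding commutant_def by simp
  qed
  then have "commutant \<C> \<subseteq> commutant (commutant \<C>)"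
    unfolding commutant_def[of "commutant \<C>"] by (blast intro: commutant_bounded_op)
  then have "commutant \<C> = \<C>"
    by (intro maxC sa C(2) subset_trans[OF C(1) C(2)])
  then show thesis by (intro that[OF C(1) _ C(3)]) simp
qed

section \<open>Masas invariant under a commutative group of unitaries\<close>

lemma id_op_apply [simp]: "f \<in> L2 M \<Longrightarrow> id_op M f = f"
  by (simp add: id_op_def)

lemma unitary_apply:
  assumes "unitary_op M V"
  shows "V \<in> bounded_ops M" "f \<in> L2 M \<Longrightarrow> adj M V (V f) = f" "f \<in> L2 M \<Longrightarrow> V (adj M V f) = f"
  using assms by (auto simp: unitary_op_def id_op_def fun_eq_iff)

lemma unitary_adj: "unitary_op M V \<Longrightarrow> unitary_op M (adj M V)"
  by (auto simp: unitary_op_def)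

lemma unitary_comp:
  assumes "unitary_op M V" "unitary_op M W"
  shows "unitary_op M (V \<circ> W)"
proof -
  note V = unitary_apply[OF assms(1)] and W = unitary_apply[OF assms(2)]
  have "adj M (V \<circ> W) = adj M W \<circ> adj M V" using V(1) W(1) by (rule adj_comp)
  moreover have "adj M W \<circ> adj M V \<circ> (V \<circ> W) = id_op M"
    by (rule bounded_op_ext) (use V W in auto)
  moreover have "V \<circ> W \<circ> (adj M W \<circ> adj M V) = id_op M"
    by (rule bounded_op_ext) (use V W in auto)
  ultimately show ?thesis using V(1) W(1) by (simp add: unitary_op_def)
qed

text \<open>
  Multiply \<open>V P = Q V\<close> by \<open>V\<^sup>*\<close> from both sides.
\<close>

lemma unitary_intertwine_adj:
  assumes "unitary_op M V" "P \<in> bounded_ops M" "Q \<in> bounded_ops M" "V \<circ> P = Q \<circ> V"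
  shows "adj M V \<circ> Q = P \<circ> adj M V"
proof (rule bounded_op_ext)
  note V = unitary_apply[OF assms(1)]
  fix f assume f: "f \<in> L2 M"
  have "V (P (adj M V f)) = Q (V (adj M V f))"
    using fun_cong[OF assms(4)] by (simp add: fun_eq_iff)
  then have "V (P (adj M V f)) = Q f" using V f by simp
  then show "(adj M V \<circ> Q) f = (P \<circ> adj M V) f"
    using V assms(2) by (metis bounded_op_L2 comp_apply)
qed (use assms in \<open>simp_all add: unitary_op_def\<close>)

text \<open>
  The blocks are the ranges of the projections \<open>P i\<close>, permuted by the commutative group \<open>G\<close>.
  The operators of the last line are those that are scalar on every block. The proof is
  the one described at the beginning; \<open>linked i j\<close> says that some element of \<open>G\<close> carries the
  block \<open>i\<close> to the block \<open>j\<close>.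
\<close>

lemma exists_invariant_masa:
  fixes P :: "'i \<Rightarrow> 'a operator" and I :: "'i set" and G :: "'a operator set"
  assumes P_bop: "\<And>i. i \<in> I \<Longrightarrow> P i \<in> bounded_ops M"
    and P_adj: "\<And>i. i \<in> I \<Longrightarrow> adj M (P i) = P i"
    and P_idem: "\<And>i f. i \<in> I \<Longrightarrow> P i (P i f) = P i f"
    and P_orth: "\<And>i j f. i \<in> I \<Longrightarrow> j \<in> I \<Longrightarrow> i \<noteq> j \<Longrightarrow> P i (P j f) = (\<lambda>x. 0)"
    and P_sep: "\<And>f g. f \<in> L2 M \<Longrightarrow> g \<in> L2 M \<Longrightarrow> (\<And>i. i \<in> I \<Longrightarrow> P i f = P i g) \<Longrightarrow> f = g"
    and G_unitary: "\<And>V. V \<in> G \<Longrightarrow> unitary_op M V"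
    and G_id: "id_op M \<in> G"
    and G_comp: "\<And>V W. V \<in> G \<Longrightarrow> W \<in> G \<Longrightarrow> V \<circ> W \<in> G"
    and G_adj: "\<And>V. V \<in> G \<Longrightarrow> adj M V \<in> G"
    and G_comm: "\<And>V W. V \<in> G \<Longrightarrow> W \<in> G \<Longrightarrow> V \<circ> W = W \<circ> V"
    and G_permutes: "\<And>V i. V \<in> G \<Longrightarrow> i \<in> I \<Longrightarrow> \<exists>j\<in>I. V \<circ> P i = P j \<circ> V"
  shows "\<exists>\<B>. masa M \<B> \<and> (\<forall>V\<in>G. U_invariant M V \<B>) \<and>
    {T \<in> bounded_ops M. \<forall>i\<in>I. \<exists>c. T \<circ> P i = (\<lambda>f x. c * P i f x) \<and> P i \<circ> T = (\<lambda>f x. c * P i f x)} \<subseteq> \<B>"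
proof -
  note G_bop [simp] = unitary_apply(1)[OF G_unitary] and G_inv [simp] = unitary_apply(2,3)[OF G_unitary]
  note P_bop [simp] P_idem [simp]
  define linked where "linked i j \<longleftrightarrow> i \<in> I \<and> j \<in> I \<and> (\<exists>V\<in>G. V \<circ> P i = P j \<circ> V)" for i j
  have linked_refl: "linked i i" if "i \<in> I" for i
    using that G_id unfolding linked_def by (intro conjI bexI[of _ "id_op M"]) simp_all
  have linked_sym: "linked j i" if "linked i j" for i j
    using that unitary_intertwine_adj[OF G_unitary P_bop P_bop] G_adj unfolding linked_def by metis
  have linked_trans: "linked i k" if ij: "linked i j" and jk: "linked j k" for i j k
  proof -
    obtain V W where "V \<in> G" "V \<circ> P i = P j \<circ> V" "W \<in> G" "W \<circ> P j = P k \<circ> W"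
      using ij jk unfolding linked_def by blast
    then have "(W \<circ> V) \<circ> P i = P k \<circ> (W \<circ> V)" by (metis comp_assoc)
    then show ?thesis using that G_comp \<open>V \<in> G\<close> \<open>W \<in> G\<close> unfolding linked_def by blast
  qed
  \<comment> \<open>Linked blocks are linked to the same blocks, so the choice operator picks the same one for all of an orbit.\<close>
  define rep where "rep i = (SOME j. linked i j)" for i
  have rep: "linked i (rep i)" if "i \<in> I" for i
    unfolding rep_def using linked_refl[OF that] by (rule someI)
  have rep_eq: "rep i = rep j" if "linked i j" for i j
  proof -
    have "linked i = linked j" using that linked_sym linked_trans by blast
    then show ?thesis by (simp add: rep_def)
  qed
  define R where "R = rep ` I"
  have R_I: "i \<in> I" if "i \<in> R" for i using that rep by (auto simp: R_def linked_def)
  have R_unique: "i = k" if "i \<in> R" "k \<in> R" "linked i k" for i k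
  proof -
    have "rep i = i" if "i \<in> R" for i
    proof -
      obtain j where "j \<in> I" "i = rep j" using \<open>i \<in> R\<close> by (auto simp: R_def)
      then show ?thesis using rep_eq[OF rep[of j]] by simp
    qed
    then show ?thesis using that rep_eq by metis
  qed

  define \<S> where "\<S> = {P i \<circ> V \<circ> P i | i V. i \<in> I \<and> V \<in> G}"
  have S_bop: "\<S> \<subseteq> bounded_ops M" by (auto simp: \<S>_def)
  \<comment> \<open>\<open>V\<close> maps the block \<open>i\<close> to itself or to an orthogonal one; in the second case the compression vanishes.\<close>
  have fixes_or_kills: "(\<forall>f. P i (V f) = V (P i f)) \<or> (\<forall>f. P i (V (P i f)) = (\<lambda>x. 0))"
    if i: "i \<in> I" and V: "V \<in> G" for i V
  proof -
    obtain j where j: "j \<in> I" "V \<circ> P i = P j \<circ> V" using G_permutes V i by blast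
    then have Vj: "V (P i f) = P j (V f)" for f by (simp add: fun_eq_iff)
    show ?thesis
    proof (cases "j = i")
      case True
      then show ?thesis using Vj by simp
    next
      case False
      then show ?thesis using Vj P_orth i j by simp
    qed
  qed
  have S_comm: "\<S> \<subseteq> commutant \<S>"
  proof
    fix X assume "X \<in> \<S>"
    then obtain i V where i: "i \<in> I" and V: "V \<in> G" and X: "X = P i \<circ> V \<circ> P i" by (auto simp: \<S>_def)
    show "X \<in> commutant \<S>"
    proof (rule commutantI)
      fix Y f assume "Y \<in> \<S>" and f: "f \<in> L2 M"
      then obtain j W where j: "j \<in> I" and W: "W \<in> G" and Y: "Y = P j \<circ> W \<circ> P j" by (auto simp: \<S>_def)
      show "X (Y f) = Y (X f)"
      proof (cases "i = j")
        case False
        then show ?thesis using i j V W by (simp add: X Y P_orth)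
      next
        case True
        have VW: "V (W g) = W (V g)" for g using fun_cong[OF G_comm[OF V W], of g] by simp
        consider "\<forall>f. P i (V f) = V (P i f)" "\<forall>f. P i (W f) = W (P i f)"
          | "\<forall>f. P i (V (P i f)) = (\<lambda>x. 0)" | "\<forall>f. P i (W (P i f)) = (\<lambda>x. 0)"
          using fixes_or_kills[OF i V] fixes_or_kills[OF i W] by blast
        then show ?thesis
        proof cases
          case 1
          then show ?thesis using i True by (simp add: X Y VW[of "P j f"])
        qed (use i V W True in \<open>simp_all add: X Y\<close>)
      qed
    qed (use S_bop i V X in auto)
  qed
  have S_adj: "self_adjoint_set M \<S>"
    unfolding self_adjoint_set_def
  proof
    fix X assume "X \<in> \<S>"
    then obtain i V where "i \<in> I" "V \<in> G" "X = P i \<circ> V \<circ> P i" by (auto simp: \<S>_def)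
    then have "adj M X = P i \<circ> adj M V \<circ> P i" by (simp add: adj_comp P_adj comp_assoc)
    then show "adj M X \<in> \<S>" using \<open>i \<in> I\<close> \<open>V \<in> G\<close> G_adj unfolding \<S>_def by blast
  qed
  obtain \<C> where SC: "\<S> \<subseteq> \<C>" and C: "\<C> = commutant \<C>" and C_adj: "self_adjoint_set M \<C>"
    by (rule self_commutant_extension[OF S_comm S_adj])
  have C_bop [simp]: "c \<in> bounded_ops M" if "c \<in> \<C>" for c
    using that C commutant_bounded_op by blast
  have C_comm: "c (d f) = d (c f)" if "c \<in> \<C>" "d \<in> \<C>" for c d f
    using commutant_apply[of c \<C> d f] that C by simp
  have C_I: "T \<in> \<C>" if "T \<in> bounded_ops M" "\<And>d f. d \<in> \<C> \<Longrightarrow> f \<in> L2 M \<Longrightarrow> T (d f) = d (T f)" for T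
  proof -
    have "T \<in> commutant \<C>" by (rule commutantI) (use that C_bop in auto)
    then show ?thesis using C by simp
  qed
  have C_id: "id_op M \<in> \<C>"
    by (rule C_I) simp_all
  have C_P: "P i \<in> \<C>" if "i \<in> I" for i
  proof -
    have "P i = P i \<circ> id_op M \<circ> P i" using that by (simp add: fun_eq_iff)
    then have "P i \<in> \<S>" using that G_id unfolding \<S>_def by blast
    then show ?thesis using SC by blast
  qed
  have C_compression: "P i \<circ> V \<circ> P i \<in> \<C>" if "i \<in> I" "V \<in> G" for i V
    using SC that unfolding \<S>_def by blast

  define \<N> where "\<N> = {V \<circ> P i \<circ> c \<circ> P i \<circ> adj M V | V i c. V \<in> G \<and> i \<in> R \<and> c \<in> \<C>}"
  have N_I: "V \<circ> P i \<circ> c \<circ> P i \<circ> adj M V \<in> \<N>" if "V \<in> G" "i \<in> R" "c \<in> \<C>" for V i c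
    using that unfolding \<N>_def by blast
  have N_bop: "\<N> \<subseteq> bounded_ops M" by (auto simp: \<N>_def dest: R_I)
  have move: "\<exists>j\<in>I. linked i j \<and> (\<forall>f. V (P i f) = P j (V f)) \<and> (\<forall>f. P i (adj M V f) = adj M V (P j f))"
    if V: "V \<in> G" and i: "i \<in> I" for V i
  proof -
    obtain j where j: "j \<in> I" "V \<circ> P i = P j \<circ> V" using G_permutes V i by blast
    then have "adj M V \<circ> P j = P i \<circ> adj M V"
      using unitary_intertwine_adj G_unitary V i by simp
    then show ?thesis using j V i unfolding linked_def by (intro bexI[of _ j]) (auto simp: fun_eq_iff)
  qed
  \<comment> \<open>Every element of \<open>\<N>\<close> lives on a single block \<open>j\<close>, the image of \<open>i\<close> under \<open>V\<close>.\<close>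
  have corner: "\<exists>j\<in>I. linked i j \<and> (\<forall>f. P j (X f) = X f) \<and> (\<forall>f. X (P j f) = X f) \<and>
      (\<forall>f. V (P i f) = P j (V f)) \<and> (\<forall>f. P i (adj M V f) = adj M V (P j f))"
    if V: "V \<in> G" and i: "i \<in> I" and X: "X = V \<circ> P i \<circ> c \<circ> P i \<circ> adj M V" for V i c X
  proof -
    obtain j where j: "j \<in> I" "linked i j" "\<And>f. V (P i f) = P j (V f)"
      "\<And>f. P i (adj M V f) = adj M V (P j f)" using move[OF V i] by blast
    have "P j (X f) = X f" for f using j(1) by (simp add: X j(3))
    moreover have "X (P j f) = X f" for f
      using j(1) by (simp add: X j(4))
    ultimately show ?thesis using j by blast
  qed
  have N_comm: "\<N> \<subseteq> commutant \<N>"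
  proof
    fix X assume "X \<in> \<N>"
    then obtain V i c where V: "V \<in> G" and iR: "i \<in> R" and c: "c \<in> \<C>"
      and X: "X = V \<circ> P i \<circ> c \<circ> P i \<circ> adj M V" by (auto simp: \<N>_def)
    have i: "i \<in> I" using iR by (rule R_I)
    obtain j where j: "j \<in> I" "linked i j" "\<And>f. P j (X f) = X f" "\<And>f. X (P j f) = X f"
      "\<And>f. V (P i f) = P j (V f)" "\<And>f. P i (adj M V f) = adj M V (P j f)"
      using corner[OF V i X] by blast
    have X_bop: "X \<in> bounded_ops M" using \<open>X \<in> \<N>\<close> N_bop by blast
    show "X \<in> commutant \<N>"
    proof (rule commutantI[OF X_bop N_bop])
      fix Y f assume YN: "Y \<in> \<N>" and f: "f \<in> L2 M"
      then obtain W k d where W: "W \<in> G" and kR: "k \<in> R" and d: "d \<in> \<C>"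
        and Y: "Y = W \<circ> P k \<circ> d \<circ> P k \<circ> adj M W" by (auto simp: \<N>_def)
      have k: "k \<in> I" using kR by (rule R_I)
      obtain l where l: "l \<in> I" "linked k l" "\<And>f. P l (Y f) = Y f" "\<And>f. Y (P l f) = Y f"
        "\<And>f. W (P k f) = P l (W f)" "\<And>f. P k (adj M W f) = adj M W (P l f)"
        using corner[OF W k Y] by blast
      have Y_bop: "Y \<in> bounded_ops M" using YN N_bop by blast
      show "X (Y f) = Y (X f)"
      proof (cases "j = l")
        case False
        have "X (Y f) = X (P j (P l (Y f)))" by (simp only: j(4) l(3))
        also have "\<dots> = (\<lambda>x. 0)" using P_orth[OF j(1) l(1) False] X_bop by simp
        finally have XY: "X (Y f) = (\<lambda>x. 0)" .
        have "Y (X f) = Y (P l (P j (X f)))" by (simp only: j(3) l(4))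
        also have "\<dots> = (\<lambda>x. 0)" using P_orth[OF l(1) j(1)] False Y_bop by auto
        finally show ?thesis using XY by simp
      next
        case True
        then have "k = i" using R_unique[OF kR iR] linked_trans[OF l(2)] linked_sym[OF j(2)] by simp
        \<comment> \<open>\<open>V\<close> and \<open>W\<close> carry the block \<open>i\<close> to the same block, so \<open>Z\<close> returns to \<open>i\<close>.\<close>
        define Z where "Z = adj M V \<circ> W"
        have Z: "Z \<in> G" unfolding Z_def using V W G_adj G_comp by simp
        have Z_P: "Z (P i g) = P i (Z g)" for g
          using l(5) j(6) True by (simp add: Z_def \<open>k = i\<close>)
        have Z'_P: "P i (adj M Z g) = adj M Z (P i g)" for g
        proof -
          have "adj M Z \<circ> P i = P i \<circ> adj M Z"
            by (rule unitary_intertwine_adj[OF G_unitary[OF Z] P_bop[OF i] P_bop[OF i]]) (simp add: fun_eq_iff Z_P)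
          then show ?thesis by (simp add: fun_eq_iff)
        qed
        have adjZ: "adj M Z g = adj M W (V g)" for g
          using V W by (simp add: Z_def adj_comp)
        let ?Q = "P i \<circ> adj M Z \<circ> P i"
        have Q: "?Q \<in> \<C>" using C_compression[OF i] G_adj[OF Z] by simp
        \<comment> \<open>\<open>Z\<close> commutes with \<open>d\<close> on the block, so \<open>W\<close> may be replaced by \<open>V\<close> in \<open>Y\<close>.\<close>
        have Y_V: "Y h = V (P i (d (P i (adj M V h))))" if h: "h \<in> L2 M" for h
        proof -
          let ?g = "adj M V h"
          have g: "?g \<in> L2 M" using V by simp
          have W_g: "adj M W h = adj M Z ?g" using V h by (simp add: adjZ)
          have "W u = V (Z u)" if "u \<in> L2 M" for u using V W that by (simp add: Z_def)
          then have "Y h = V (Z (P i (d (P i (adj M Z ?g)))))"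
            using i d V W Z by (simp add: Y \<open>k = i\<close> W_g)
          also have "P i (adj M Z ?g) = ?Q ?g" using i by (simp add: Z'_P)
          also have "d (?Q ?g) = ?Q (d ?g)" using C_comm[OF d Q] .
          also have "P i (?Q (d ?g)) = adj M Z (P i (d ?g))"
            using i by (simp add: Z'_P)
          also have "Z (adj M Z (P i (d ?g))) = P i (d ?g)" using Z i d by simp
          also have "\<dots> = P i (d (P i ?g))" using i C_comm[OF d C_P[OF i]] by simp
          finally show ?thesis .
        qed
        note comm = C_comm[OF c C_P[OF i]] C_comm[OF d C_P[OF i]] C_comm[OF c d]
        show ?thesis
          using i c d V f by (simp add: Y_V X comm)
      qed
    qed
  qed
  have N_adj: "self_adjoint_set M \<N>"
    unfolding self_adjoint_set_def
  proof
    fix X assume "X \<in> \<N>"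
    then obtain V i c where V: "V \<in> G" and i: "i \<in> R" and c: "c \<in> \<C>"
      and X: "X = V \<circ> P i \<circ> c \<circ> P i \<circ> adj M V" by (auto simp: \<N>_def)
    have "adj M X = V \<circ> P i \<circ> adj M c \<circ> P i \<circ> adj M V"
      using V R_I[OF i] c by (simp add: X adj_comp P_adj comp_assoc)
    moreover have "adj M c \<in> \<C>" using c C_adj by (simp add: self_adjoint_set_def)
    ultimately show "adj M X \<in> \<N>" using V i unfolding \<N>_def by blast
  qed

  define \<B> where "\<B> = commutant \<N>"
  have B_bop [simp]: "T \<in> bounded_ops M" if "T \<in> \<B>" for T
    using that commutant_bounded_op by (simp add: \<B>_def)
  have B_N: "T (X f) = X (T f)" if "T \<in> \<B>" "X \<in> \<N>" for T X f
    using that by (simp add: \<B>_def commutant_apply[of T \<N> X])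
  have reach: "\<exists>i\<in>R. \<exists>V\<in>G. (\<forall>f. V (P i f) = P j (V f)) \<and> (\<forall>f. P i (adj M V f) = adj M V (P j f))"
    if j: "j \<in> I" for j
  proof -
    have "rep j \<in> R" using j by (simp add: R_def)
    moreover have "linked (rep j) j" using rep[OF j] linked_sym by blast
    then obtain V where V: "V \<in> G" "V \<circ> P (rep j) = P j \<circ> V" "rep j \<in> I" unfolding linked_def by blast
    moreover from V have "adj M V \<circ> P j = P (rep j) \<circ> adj M V"
      using unitary_intertwine_adj[OF G_unitary P_bop P_bop] j by blast
    ultimately show ?thesis
      by (intro bexI[of _ "rep j"] bexI[of _ V]) (simp_all add: fun_eq_iff)
  qed
  \<comment> \<open>\<open>P j\<close> belongs to \<open>\<N>\<close>: take \<open>c\<close> to be the identity.\<close>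
  have B_P: "T (P j f) = P j (T f)" if T: "T \<in> \<B>" and j: "j \<in> I" for T j f
  proof -
    obtain i V where i: "i \<in> R" and V: "V \<in> G" and VP: "\<And>f. V (P i f) = P j (V f)"
      using reach[OF j] by blast
    have "V \<circ> P i \<circ> id_op M \<circ> P i \<circ> adj M V = P j"
      by (rule bounded_op_ext) (use V R_I[OF i] j in \<open>simp_all add: VP\<close>)
    then have "P j \<in> \<N>" using N_I[OF V i C_id] by simp
    then show ?thesis using B_N T by blast
  qed
  have B_compression: "P i \<circ> adj M V \<circ> T \<circ> V \<circ> P i \<in> \<C>"
    if T: "T \<in> \<B>" and i: "i \<in> R" and V: "V \<in> G" for T i V
  proof (rule C_I)
    have iI: "i \<in> I" using i by (rule R_I)
    fix d f assume d: "d \<in> \<C>" and f: "f \<in> L2 M"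
    note dP = C_comm[OF d C_P[OF iI]]
    let ?X = "V \<circ> P i \<circ> d \<circ> P i \<circ> adj M V"
    have X: "?X \<in> \<N>" using V i d by (rule N_I)
    have X_V: "?X (V g) = V (P i (d g))" if "g \<in> L2 M" for g
      using that V iI by (simp add: dP)
    have V_X: "P i (adj M V (?X g)) = P i (d (adj M V g))" if "g \<in> L2 M" for g
      using that V iI d by (simp add: dP)
    have "T (V (P i (d (P i f)))) = ?X (T (V (P i f)))"
      using B_N[OF T X, of "V (P i f)"] X_V[of "P i f"] iI by simp
    then have "P i (adj M V (T (V (P i (d (P i f)))))) = P i (d (adj M V (T (V (P i f)))))"
      using V_X[of "T (V (P i f))"] T by simp
    then show "(P i \<circ> adj M V \<circ> T \<circ> V \<circ> P i) (d f) = d ((P i \<circ> adj M V \<circ> T \<circ> V \<circ> P i) f)"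
      using iI by (simp add: dP)
  qed (use that R_I in simp)
  have B_comm: "S (T f) = T (S f)" if S: "S \<in> \<B>" and T: "T \<in> \<B>" and f: "f \<in> L2 M" for S T f
  proof (rule P_sep)
    fix j assume j: "j \<in> I"
    obtain i V where i: "i \<in> R" and V: "V \<in> G"
      and VP: "\<And>f. V (P i f) = P j (V f)" and PV: "\<And>f. P i (adj M V f) = adj M V (P j f)"
      using reach[OF j] by blast
    let ?c = "\<lambda>T. P i \<circ> adj M V \<circ> T \<circ> V \<circ> P i"
    have block: "P j (T g) = V (?c T (adj M V g))" if "T \<in> \<B>" "g \<in> L2 M" for T g
      using that V j by (simp add: VP PV B_P)
    \<comment> \<open>Both factors respect the block \<open>j\<close>, so their product is computed inside \<open>\<C>\<close>.\<close>
    have product: "P j (S (T f)) = V (?c S (?c T (adj M V f)))" if S: "S \<in> \<B>" and T: "T \<in> \<B>" for S T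
    proof -
      have "P j (S (T f)) = P j (S (P j (T f)))" using S j by (simp add: B_P)
      also have "\<dots> = V (?c S (adj M V (V (?c T (adj M V f)))))"
        using S T f j by (subst block[of S]) (simp_all only: block[OF T f] bounded_op_L2 G_bop[OF V])
      also have "\<dots> = V (?c S (?c T (adj M V f)))" using V T R_I[OF i] by simp
      finally show ?thesis .
    qed
    show "P j (S (T f)) = P j (T (S f))"
      unfolding product[OF S T] product[OF T S]
      using C_comm[OF B_compression[OF S i V] B_compression[OF T i V]] by simp
  qed (use S T in simp_all)
  have B_sub: "\<B> \<subseteq> bounded_ops M" by auto
  have "\<B> \<subseteq> commutant \<B>"
    using commutantI[OF B_bop B_sub] B_comm by blast
  moreover have "commutant \<B> \<subseteq> \<B>"
    unfolding \<B>_def by (intro commutant_antimono N_comm)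
  ultimately have "masa M \<B>"
    unfolding \<B>_def by (intro masa_if_own_commutant commutant_self_adjoint N_bop N_adj) blast
  moreover have "U_invariant M V \<B>" if V: "V \<in> G" for V
    unfolding U_invariant_def conj_op_def
  proof
    fix T assume T: "T \<in> \<B>"
    show "adj M V \<circ> T \<circ> V \<in> \<B>"
      unfolding \<B>_def
    proof (rule commutantI[OF _ N_bop])
      fix X f assume "X \<in> \<N>" and f: "f \<in> L2 M"
      then obtain W i c where W: "W \<in> G" "i \<in> R" "c \<in> \<C>"
        and X: "X = W \<circ> P i \<circ> c \<circ> P i \<circ> adj M W" by (auto simp: \<N>_def)
      let ?Y = "V \<circ> X \<circ> adj M V"
      have X_bop: "X \<in> bounded_ops M" using \<open>X \<in> \<N>\<close> N_bop by blast
      have "?Y = (V \<circ> W) \<circ> P i \<circ> c \<circ> P i \<circ> adj M (V \<circ> W)"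
        using V W by (simp add: X adj_comp comp_assoc)
      then have "?Y \<in> \<N>" using N_I[OF G_comp[OF V W(1)] W(2,3)] by simp
      then have "T (?Y (V f)) = ?Y (T (V f))" using B_N T by blast
      then have "T (V (X f)) = V (X (adj M V (T (V f))))" using V f by simp
      then show "(adj M V \<circ> T \<circ> V) (X f) = X ((adj M V \<circ> T \<circ> V) f)"
        using V X_bop by simp
    qed (use T V in simp)
  qed
  moreover have "T \<in> \<B>" if T: "T \<in> bounded_ops M"
    and scalar: "\<And>i. i \<in> I \<Longrightarrow> \<exists>c. T \<circ> P i = (\<lambda>f x. c * P i f x) \<and> P i \<circ> T = (\<lambda>f x. c * P i f x)" for T
    unfolding \<B>_def
  proof (rule commutantI[OF T N_bop])
    fix X f assume "X \<in> \<N>" and f: "f \<in> L2 M"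
    then obtain V i c where V: "V \<in> G" "i \<in> R"
      and X: "X = V \<circ> P i \<circ> c \<circ> P i \<circ> adj M V" by (auto simp: \<N>_def)
    have X_bop: "X \<in> bounded_ops M" using \<open>X \<in> \<N>\<close> N_bop by blast
    obtain j where j: "j \<in> I" "\<And>f. P j (X f) = X f" "\<And>f. X (P j f) = X f"
      using corner[OF V(1) R_I[OF V(2)] X] by blast
    obtain c where c: "T (P j f) = (\<lambda>x. c * P j f x)" "P j (T f) = (\<lambda>x. c * P j f x)" for f
      using scalar[OF j(1)] by (auto simp: fun_eq_iff)
    have "T (X f) = (\<lambda>x. c * X f x)" using c(1)[of "X f"] by (simp add: j(2))
    moreover have "X (T f) = X (\<lambda>x. c * P j f x)" using c(2)[of f] j(3)[of "T f"] by simp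
    moreover have "\<dots> = (\<lambda>x. c * X f x)"
      using bounded_op_scale[OF X_bop, of "P j f" c] j by simp
    ultimately show "T (X f) = X (T f)" by simp
  qed
  ultimately show ?thesis by blast
qed

section \<open>The group generated by a unitary\<close>

text \<open>
  For a unitary \<open>U\<close> this is the cyclic group of its integer powers; the closure form makes
  induction handle positive and negative powers alike.
\<close>

definition generated :: "'a operator \<Rightarrow> 'a operator set" where
  "generated U = \<Inter>{H. id_op M \<in> H \<and> (\<forall>V\<in>H. U \<circ> V \<in> H \<and> adj M U \<circ> V \<in> H)}"

lemma generated_one: "id_op M \<in> generated U"
  and generated_times: "V \<in> generated U \<Longrightarrow> U \<circ> V \<in> generated U"
  and generated_divide: "V \<in> generated U \<Longrightarrow> adj M U \<circ> V \<in> generated U"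
  by (auto simp: generated_def)

lemma generated_induct [consumes 1, case_names one times divide]:
  assumes "V \<in> generated U" "Q (id_op M)"
    and "\<And>V. V \<in> generated U \<Longrightarrow> Q V \<Longrightarrow> Q (U \<circ> V)"
    and "\<And>V. V \<in> generated U \<Longrightarrow> Q V \<Longrightarrow> Q (adj M U \<circ> V)"
  shows "Q V"
proof -
  let ?H = "{V \<in> generated U. Q V}"
  have "id_op M \<in> ?H \<and> (\<forall>V\<in>?H. U \<circ> V \<in> ?H \<and> adj M U \<circ> V \<in> ?H)"
    using assms(2-) by (simp add: generated_one generated_times generated_divide)
  then have "generated U \<subseteq> ?H" unfolding generated_def by (intro Inter_lower CollectI)
  then show ?thesis using assms(1) by blast
qed

context
  fixes U :: "'a operator"
  assumes U: "unitary_op M U"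
begin

lemma U_cancel: "U \<in> bounded_ops M" "adj M U \<circ> U = id_op M" "U \<circ> adj M U = id_op M"
  using U by (simp_all add: unitary_op_def)

lemma generated_unitary:
  assumes "V \<in> generated U"
  shows "unitary_op M V"
  using assms
proof (rule generated_induct)
  show "unitary_op M (id_op M)" by (simp add: unitary_op_def)
  fix V assume V: "unitary_op M V"
  show "unitary_op M (U \<circ> V)" by (rule unitary_comp[OF U V])
  show "unitary_op M (adj M U \<circ> V)" by (rule unitary_comp[OF unitary_adj[OF U] V])
qed

lemma generated_bounded_op: "V \<in> generated U \<Longrightarrow> V \<in> bounded_ops M"
  using generated_unitary by (simp add: unitary_op_def)

lemma generated_self: "U \<in> generated U"
  using generated_times[OF generated_one, of U] U_cancel(1) by simp

lemma generated_comp: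
  assumes "V \<in> generated U" "W \<in> generated U"
  shows "V \<circ> W \<in> generated U"
  using assms(1)
proof (rule generated_induct)
  show "id_op M \<circ> W \<in> generated U" using assms(2) by (simp add: generated_bounded_op)
qed (simp_all only: comp_assoc generated_times generated_divide)

lemma generated_comm_self:
  assumes "V \<in> generated U"
  shows "V \<circ> U = U \<circ> V \<and> V \<circ> adj M U = adj M U \<circ> V"
  using assms
proof (rule generated_induct)
  have cancel: "adj M U \<circ> (U \<circ> W) = W" "U \<circ> (adj M U \<circ> W) = W" if "W \<in> bounded_ops M" for W
    using U_cancel that by (simp_all flip: comp_assoc)
  show "id_op M \<circ> U = U \<circ> id_op M \<and> id_op M \<circ> adj M U = adj M U \<circ> id_op M"
    using U_cancel by simp
  fix V assume "V \<in> generated U" and "V \<circ> U = U \<circ> V \<and> V \<circ> adj M U = adj M U \<circ> V"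
  then have V: "V \<in> bounded_ops M" "V \<circ> U = U \<circ> V" "V \<circ> adj M U = adj M U \<circ> V"
    by (simp_all only: generated_bounded_op)
  show "(U \<circ> V) \<circ> U = U \<circ> (U \<circ> V) \<and> (U \<circ> V) \<circ> adj M U = adj M U \<circ> (U \<circ> V)"
    "(adj M U \<circ> V) \<circ> U = U \<circ> (adj M U \<circ> V) \<and> (adj M U \<circ> V) \<circ> adj M U = adj M U \<circ> (adj M U \<circ> V)"
    by (simp_all only: comp_assoc V cancel)
qed

lemma generated_comm:
  assumes "V \<in> generated U" "W \<in> generated U"
  shows "V \<circ> W = W \<circ> V"
  using assms(1)
proof (rule generated_induct)
  note W = generated_comm_self[OF assms(2)]
  show "id_op M \<circ> W = W \<circ> id_op M" using generated_bounded_op[OF assms(2)] by simp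
  fix V assume V: "V \<circ> W = W \<circ> V"
  show "(U \<circ> V) \<circ> W = W \<circ> (U \<circ> V)" using W V by (metis comp_assoc)
  show "(adj M U \<circ> V) \<circ> W = W \<circ> (adj M U \<circ> V)" using W V by (metis comp_assoc)
qed

lemma generated_adj:
  assumes "V \<in> generated U"
  shows "adj M V \<in> generated U"
  using assms
proof (rule generated_induct)
  show "adj M (id_op M) \<in> generated U" by (simp add: generated_one)
  fix V assume V: "V \<in> generated U" and V': "adj M V \<in> generated U"
  have "adj M (U \<circ> V) = adj M U \<circ> adj M V" "adj M (adj M U \<circ> V) = U \<circ> adj M V"
    using generated_comm_self[OF V'] generated_bounded_op[OF V] U_cancel(1) by (simp_all add: adj_comp)
  then show "adj M (U \<circ> V) \<in> generated U" "adj M (adj M U \<circ> V) \<in> generated U"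
    using generated_times[OF V'] generated_divide[OF V'] by simp_all
qed

end

section \<open>Level sets as joint eigenspaces\<close>

definition level_set :: "'a operator set \<Rightarrow> 'a \<Rightarrow> 'a set" where
  "level_set \<A> x = {y \<in> space M. \<forall>f. mult_op M f \<in> \<A> \<longrightarrow> f y = f x}"

lemma level_set_eq: "y \<in> level_set \<A> x \<Longrightarrow> level_set \<A> y = level_set \<A> x"
  by (auto simp: level_set_def)

lemma level_set_self: "x \<in> space M \<Longrightarrow> x \<in> level_set \<A> x"
  by (auto simp: level_set_def)

lemma projection_apply: "f \<in> L2 M \<Longrightarrow> mult_op M (indicator E) f z = (if z \<in> E then f z else 0)"
  by (auto simp: mult_op_def indicator_def)

lemma projection_projection:
  "mult_op M (indicator E) (mult_op M (indicator F) f) = mult_op M (indicator (E \<inter> F)) f"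
proof (cases "f \<in> L2 M")
  case True
  then show ?thesis
    using bounded_op_L2[OF bounded_op_projection, of F f] by (simp add: fun_eq_iff projection_apply)
next
  case False
  then show ?thesis
    by (simp add: bounded_op_outside[OF bounded_op_projection] bounded_op_zero[OF bounded_op_projection])
qed

text \<open>
  For \<open>M\<^sub>f \<in> \<A>\<close> write \<open>V\<^sup>* M\<^sub>f V = M\<^sub>g\<close> with \<open>g = \<phi> f\<close>. If \<open>k\<close> lives on the level set of \<open>x\<close>, then
  \<open>M\<^sub>f V k = V M\<^sub>g k = g x \<cdot> V k\<close>, so \<open>V k\<close> is a joint eigenvector with eigenvalues that depend
  on \<open>x\<close> only. Hence \<open>f = g x\<close> wherever \<open>V k\<close> does not vanish, and any two such points lie in
  the same level set. The point \<open>y\<close> is one where the image of \<open>\<delta>\<^sub>x\<close> does not vanish.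
\<close>

lemma unitary_maps_level_set_into_level_set:
  assumes V: "unitary_op M V" and \<A>: "\<A> \<subseteq> bounded_ops M" "\<A> \<subseteq> range (mult_op M)"
    and inv: "\<And>T. T \<in> \<A> \<Longrightarrow> adj M V \<circ> T \<circ> V \<in> \<A>"
    and x: "x \<in> space M"
  shows "\<exists>y\<in>space M. \<forall>k\<in>L2 M. (\<forall>z. z \<notin> level_set \<A> x \<longrightarrow> k z = 0) \<longrightarrow>
    (\<forall>z. z \<notin> level_set \<A> y \<longrightarrow> V k z = 0)"
proof -
  note V' = unitary_apply[OF V]
  have "\<exists>g. mult_op M g = adj M V \<circ> mult_op M f \<circ> V" if "mult_op M f \<in> \<A>" for f
    using inv[OF that] \<A>(2) by fastforce
  then obtain \<phi> where \<phi>: "\<And>f. mult_op M f \<in> \<A> \<Longrightarrow> mult_op M (\<phi> f) = adj M V \<circ> mult_op M f \<circ> V"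
    by metis
  have eigen: "f z * V k z = \<phi> f x * V k z"
    if k: "k \<in> L2 M" "\<And>z. z \<notin> level_set \<A> x \<Longrightarrow> k z = 0" and f: "mult_op M f \<in> \<A>" for k f z
  proof -
    have \<phi>f: "mult_op M (\<phi> f) \<in> \<A>" using \<phi>[OF f] inv[OF f] by simp
    have "\<phi> f u * k u = \<phi> f x * k u" for u
      using k(2)[of u] \<phi>f by (cases "u \<in> level_set \<A> x") (simp_all add: level_set_def)
    then have "mult_op M (\<phi> f) k = (\<lambda>u. \<phi> f x * k u)" using k(1) unfolding mult_op_def by (simp only: if_True)
    then have "adj M V (mult_op M f (V k)) = (\<lambda>u. \<phi> f x * k u)" using \<phi>[OF f] by simp
    then have "V (adj M V (mult_op M f (V k))) = (\<lambda>u. \<phi> f x * V k u)"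
      using bounded_op_scale[OF V'(1) k(1)] by simp
    moreover have "mult_op M f (V k) \<in> L2 M" using f \<A>(1) by (intro bounded_op_L2) auto
    ultimately have "mult_op M f (V k) = (\<lambda>u. \<phi> f x * V k u)" using V'(3) by simp
    then show ?thesis using V'(1) by (simp add: mult_op_def fun_eq_iff)
  qed
  have delta: "delta x u = 0" if "u \<notin> level_set \<A> x" for u
    using that level_set_self[OF x] by (auto simp: delta_def)
  have "V (delta x) \<noteq> (\<lambda>z. 0)"
  proof
    assume "V (delta x) = (\<lambda>z. 0)"
    then have "delta x = (\<lambda>z. 0)" using V'(2)[of "delta x"] V'(1) x by simp
    then have "delta x x = 0" by (rule fun_cong)
    then show False by (simp add: delta_def)
  qed
  then obtain y where y: "V (delta x) y \<noteq> 0" by auto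
  have in_space: "z \<in> space M" if "V k z \<noteq> 0" for k z
    using bounded_op_L2[OF V'(1), of k] that by (auto simp: L2_iff)
  show ?thesis
  proof (intro bexI ballI allI impI)
    show "y \<in> space M" using y by (rule in_space)
    fix k z assume "k \<in> L2 M" "\<forall>z. z \<notin> level_set \<A> x \<longrightarrow> k z = 0" and z: "z \<notin> level_set \<A> y"
    then have k: "k \<in> L2 M" "\<And>z. z \<notin> level_set \<A> x \<Longrightarrow> k z = 0" by simp_all
    show "V k z = 0"
    proof (rule ccontr)
      assume nz: "V k z \<noteq> 0"
      have "f z = f y" if f: "mult_op M f \<in> \<A>" for f
        using eigen[OF k f, of z] eigen[OF delta_L2[OF x] delta f, of y] nz y by simp
      then show False using z in_space[OF nz] by (simp add: level_set_def)
    qed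
  qed
qed

text \<open>
  \<open>V\<close> maps the block of \<open>x\<close> into that of some \<open>y\<close>, and \<open>V\<^sup>*\<close> maps the block of \<open>y\<close> into that
  of some \<open>w\<close>. Following \<open>\<delta>\<^sub>x\<close> shows that the last block is the first one. The two inclusions
  read \<open>V P\<^sub>x = P\<^sub>y V P\<^sub>x\<close> and \<open>V\<^sup>* P\<^sub>y = P\<^sub>x V\<^sup>* P\<^sub>y\<close>, and the adjoint of the second is
  \<open>P\<^sub>y V = P\<^sub>y V P\<^sub>x\<close>.
\<close>

lemma unitary_permutes_level_sets:
  assumes V: "unitary_op M V" and \<A>: "\<A> \<subseteq> bounded_ops M" "\<A> \<subseteq> range (mult_op M)"
    and inv: "\<And>T. T \<in> \<A> \<Longrightarrow> adj M V \<circ> T \<circ> V \<in> \<A>"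
    and inv': "\<And>T. T \<in> \<A> \<Longrightarrow> V \<circ> T \<circ> adj M V \<in> \<A>"
    and x: "x \<in> space M"
  shows "\<exists>y\<in>space M. V \<circ> mult_op M (indicator (level_set \<A> x)) = mult_op M (indicator (level_set \<A> y)) \<circ> V"
proof -
  note V' = unitary_apply[OF V]
  let ?P = "\<lambda>x. mult_op M (indicator (level_set \<A> x))"
  obtain y where y: "y \<in> space M"
    "\<And>k z. k \<in> L2 M \<Longrightarrow> (\<And>z. z \<notin> level_set \<A> x \<Longrightarrow> k z = 0) \<Longrightarrow> z \<notin> level_set \<A> y \<Longrightarrow> V k z = 0"
    using unitary_maps_level_set_into_level_set[OF V \<A> inv x] by blast
  obtain w where w: "w \<in> space M"
    "\<And>k z. k \<in> L2 M \<Longrightarrow> (\<And>z. z \<notin> level_set \<A> y \<Longrightarrow> k z = 0) \<Longrightarrow> z \<notin> level_set \<A> w \<Longrightarrow> adj M V k z = 0"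
  proof -
    have "adj M (adj M V) \<circ> T \<circ> adj M V \<in> \<A>" if "T \<in> \<A>" for T
      using inv'[OF that] V'(1) by simp
    from unitary_maps_level_set_into_level_set[OF unitary_adj[OF V] \<A> this y(1)] show thesis
      using that by blast
  qed
  have "x \<in> level_set \<A> w"
  proof (rule ccontr)
    assume "x \<notin> level_set \<A> w"
    moreover have "delta x u = 0" if "u \<notin> level_set \<A> x" for u
      using that level_set_self[OF x] by (auto simp: delta_def)
    ultimately have "adj M V (V (delta x)) x = 0"
      using V'(1) x by (intro w(2) y(2)) simp_all
    then have "delta x x = 0" using V'(2)[of "delta x"] x by simp
    then show False by (simp add: delta_def)
  qed
  then have wx: "level_set \<A> w = level_set \<A> x" using level_set_eq by blast
  have "V \<circ> ?P x = ?P y \<circ> (V \<circ> ?P x)"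
  proof (rule bounded_op_ext)
    fix f assume f: "f \<in> L2 M"
    show "(V \<circ> ?P x) f = (?P y \<circ> (V \<circ> ?P x)) f"
    proof
      fix z show "(V \<circ> ?P x) f z = (?P y \<circ> (V \<circ> ?P x)) f z"
        using y(2)[of "?P x f" z] f V'(1) bounded_op_projection by (simp add: projection_apply)
    qed
  qed (simp_all add: V' bounded_op_projection)
  moreover have "adj M V \<circ> ?P y = ?P x \<circ> (adj M V \<circ> ?P y)"
  proof (rule bounded_op_ext)
    fix f assume f: "f \<in> L2 M"
    show "(adj M V \<circ> ?P y) f = (?P x \<circ> (adj M V \<circ> ?P y)) f"
    proof
      fix z show "(adj M V \<circ> ?P y) f z = (?P x \<circ> (adj M V \<circ> ?P y)) f z"
        using w(2)[of "?P y f" z] f V'(1) bounded_op_projection by (simp add: projection_apply wx)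
    qed
  qed (simp_all add: V' bounded_op_projection)
  then have "adj M (adj M V \<circ> ?P y) = adj M (?P x \<circ> (adj M V \<circ> ?P y))" by simp
  then have "?P y \<circ> V = ?P y \<circ> V \<circ> ?P x"
    by (simp add: adj_comp V' bounded_op_projection adj_projection)
  ultimately show ?thesis using y(1) by (metis comp_assoc)
qed

end

section \<open>Existence of the invariant masa\<close>

theorem theorem2p5:
  fixes M :: "'a measure" and U :: "'a operator" and \<A> :: "'a operator set"
  assumes "discrete_measure_space M"
    and "L2_infinite_dimensional M"
    and "unitary_op M U"
    and "abelian_self_adjoint_algebra M \<A>"
    and "\<A> \<subseteq> mult_op M ` Linf M"
    and "conj_op M U ` \<A> = \<A>"
  shows "\<exists>\<B>. masa M \<B> \<and> \<A> \<subseteq> \<B> \<and> U_invariant M U \<B>"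
proof -
  interpret discrete_L2 M by unfold_locales (rule assms)
  note U = \<open>unitary_op M U\<close>
  have \<A>: "\<A> \<subseteq> bounded_ops M" "\<A> \<subseteq> range (mult_op M)"
    using assms(4,5) unfolding abelian_self_adjoint_algebra_def op_subalgebra_def by blast+
  have inv: "adj M U \<circ> T \<circ> U \<in> \<A>" if "T \<in> \<A>" for T
  proof -
    have "conj_op M U T \<in> conj_op M U ` \<A>" using that by (rule imageI)
    then show ?thesis unfolding assms(6) by (simp only: conj_op_def)
  qed
  \<comment> \<open>This is where \<open>\<A>\<close> has to be contained in \<open>U\<^sup>* \<A> U\<close>; it lets \<open>U\<^sup>*\<close> permute the level sets as well.\<close>
  have inv': "U \<circ> T \<circ> adj M U \<in> \<A>" if "T \<in> \<A>" for T
  proof -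
    have "T \<in> conj_op M U ` \<A>" unfolding assms(6) by (rule that)
    then obtain S where S: "S \<in> \<A>" "T = adj M U \<circ> S \<circ> U"
      unfolding conj_op_def by (rule imageE)
    have "U \<circ> T \<circ> adj M U = S"
    proof (rule bounded_op_ext)
      have "S \<in> bounded_ops M" using S(1) \<A>(1) by blast
      note bop = this unitary_apply(1)[OF U]
      then show "U \<circ> T \<circ> adj M U \<in> bounded_ops M" "S \<in> bounded_ops M" by (simp_all add: S(2))
      show "(U \<circ> T \<circ> adj M U) f = S f" if "f \<in> L2 M" for f
        using that bop by (simp add: S(2) unitary_apply[OF U])
    qed
    then show ?thesis using S by simp
  qed
  let ?I = "level_set \<A> ` space M" and ?P = "\<lambda>E. mult_op M (indicator E)"
  have permutes: "\<exists>F\<in>?I. V \<circ> ?P E = ?P F \<circ> V" if "V \<in> generated U" "E \<in> ?I" for V E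
  proof -
    have U_permutes: "\<exists>F\<in>?I. U \<circ> ?P E = ?P F \<circ> U" if "E \<in> ?I" for E
      using unitary_permutes_level_sets[OF U \<A> inv inv'] that by blast
    have "adj M (adj M U) \<circ> T \<circ> adj M U \<in> \<A>" "adj M U \<circ> T \<circ> adj M (adj M U) \<in> \<A>"
      if "T \<in> \<A>" for T
      using inv[OF that] inv'[OF that] unitary_apply(1)[OF U] by simp_all
    then have U'_permutes: "\<exists>F\<in>?I. adj M U \<circ> ?P E = ?P F \<circ> adj M U" if "E \<in> ?I" for E
      using unitary_permutes_level_sets[OF unitary_adj[OF U] \<A>] that by blast
    have step: "\<exists>F\<in>?I. (W \<circ> V) \<circ> ?P E = ?P F \<circ> (W \<circ> V)"
      if W: "\<And>E. E \<in> ?I \<Longrightarrow> \<exists>F\<in>?I. W \<circ> ?P E = ?P F \<circ> W"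
        and V: "\<forall>E\<in>?I. \<exists>F\<in>?I. V \<circ> ?P E = ?P F \<circ> V" and E: "E \<in> ?I" for V W E
    proof -
      obtain F where F: "F \<in> ?I" "V \<circ> ?P E = ?P F \<circ> V" using V E by blast
      obtain F' where F': "F' \<in> ?I" "W \<circ> ?P F = ?P F' \<circ> W" using W[OF F(1)] by blast
      have "(W \<circ> V) \<circ> ?P E = ?P F' \<circ> (W \<circ> V)" using F(2) F'(2) by (metis comp_assoc)
      then show ?thesis using F'(1) by blast
    qed
    have "\<forall>E\<in>?I. \<exists>F\<in>?I. V \<circ> ?P E = ?P F \<circ> V"
      using that(1)
    proof (rule generated_induct)
      show "\<forall>E\<in>?I. \<exists>F\<in>?I. id_op M \<circ> ?P E = ?P F \<circ> id_op M"
        by (auto simp: bounded_op_projection)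
      fix V assume V: "\<forall>E\<in>?I. \<exists>F\<in>?I. V \<circ> ?P E = ?P F \<circ> V"
      show "\<forall>E\<in>?I. \<exists>F\<in>?I. (U \<circ> V) \<circ> ?P E = ?P F \<circ> (U \<circ> V)"
        using step[OF U_permutes V] by blast
      show "\<forall>E\<in>?I. \<exists>F\<in>?I. (adj M U \<circ> V) \<circ> ?P E = ?P F \<circ> (adj M U \<circ> V)"
        using step[OF U'_permutes V] by blast
    qed
    then show ?thesis using that(2) by blast
  qed
  have "\<exists>\<B>. masa M \<B> \<and> (\<forall>V\<in>generated U. U_invariant M V \<B>) \<and>
    {T \<in> bounded_ops M. \<forall>E\<in>?I. \<exists>c. T \<circ> ?P E = (\<lambda>f x. c * ?P E f x) \<and> ?P E \<circ> T = (\<lambda>f x. c * ?P E f x)} \<subseteq> \<B>"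
  proof (rule exists_invariant_masa)
    show "?P E (?P E f) = ?P E f" for E f
      by (simp add: projection_projection)
    show "?P E (?P F f) = (\<lambda>x. 0)" if "E \<in> ?I" "F \<in> ?I" "E \<noteq> F" for E F f
    proof -
      have "E \<inter> F = {}" using that level_set_eq by blast
      then show ?thesis unfolding projection_projection by (simp add: mult_op_def)
    qed
    show "f = g" if "f \<in> L2 M" "g \<in> L2 M" "\<And>E. E \<in> ?I \<Longrightarrow> ?P E f = ?P E g" for f g
    proof
      fix x show "f x = g x"
      proof (cases "x \<in> space M")
        case True
        then have "?P (level_set \<A> x) f x = ?P (level_set \<A> x) g x" using that(3) by simp
        then show ?thesis using that level_set_self[OF True] by (simp add: projection_apply)
      qed (use that in \<open>simp add: L2_iff\<close>)
    qed
  next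
    fix V W assume V: "V \<in> generated U"
    show "unitary_op M V" "adj M V \<in> generated U"
      using generated_unitary[OF U V] generated_adj[OF U V] by simp_all
    show "\<exists>F\<in>?I. V \<circ> ?P E = ?P F \<circ> V" if "E \<in> ?I" for E using V that by (rule permutes)
    assume W: "W \<in> generated U"
    show "V \<circ> W \<in> generated U" "V \<circ> W = W \<circ> V"
      using generated_comp[OF U V W] generated_comm[OF U V W] by simp_all
  qed (rule bounded_op_projection adj_projection generated_one)+
  then obtain \<B> where masa: "masa M \<B>"
    and B_invariant: "\<forall>V\<in>generated U. U_invariant M V \<B>"
    and B: "{T \<in> bounded_ops M. \<forall>E\<in>?I. \<exists>c. T \<circ> ?P E = (\<lambda>f x. c * ?P E f x) \<and>
      ?P E \<circ> T = (\<lambda>f x. c * ?P E f x)} \<subseteq> \<B>"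
    by (elim exE conjE)
  have "\<exists>c. T \<circ> ?P E = (\<lambda>f x. c * ?P E f x) \<and> ?P E \<circ> T = (\<lambda>f x. c * ?P E f x)"
    if T: "T \<in> \<A>" and E: "E \<in> ?I" for T E
  proof -
    obtain f where f: "T = mult_op M f" using T \<A>(2) by blast
    obtain x where x: "E = level_set \<A> x" using E by blast
    have fx: "f z = f x" if "z \<in> E" for z
      using that T unfolding f x level_set_def by blast
    have "T (?P E g) z = f x * ?P E g z \<and> ?P E (T g) z = f x * ?P E g z" for g z
    proof (cases "g \<in> L2 M")
      case True
      have "T g \<in> L2 M" "?P E g \<in> L2 M" using T \<A>(1) bounded_op_projection by (auto intro: bounded_op_L2)
      then show ?thesis
        unfolding f mult_op_def indicator_def using True fx[of z] f by (simp add: mult_op_def indicator_def)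
    next
      case False
      have zero: "mult_op M h (\<lambda>x. 0) = (\<lambda>x. 0)" and off: "mult_op M h g = (\<lambda>x. 0)" for h
        unfolding mult_op_def using False by simp_all
      show ?thesis by (simp only: f off zero mult_zero_right simp_thms)
    qed
    then show ?thesis by (intro exI[of _ "f x"]) (simp add: fun_eq_iff)
  qed
  then have "\<A> \<subseteq> {T \<in> bounded_ops M.
      \<forall>E\<in>?I. \<exists>c. T \<circ> ?P E = (\<lambda>f x. c * ?P E f x) \<and> ?P E \<circ> T = (\<lambda>f x. c * ?P E f x)}"
    using \<A>(1) by (intro subsetI CollectI conjI ballI) (rule subsetD)
  with B have "\<A> \<subseteq> \<B>" by (rule subset_trans[rotated])
  moreover have "U_invariant M U \<B>" using B_invariant generated_self[OF U] by (rule bspec)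
  ultimately show ?thesis using masa by (intro exI conjI)
qed

end
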